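(* Let $k$ be a field, and let $B$, $A$, $A'$, $L$ be cosemisimple Hopf algebras over $k$. Suppose given two pre-exact sequences of Hopf algebra maps $$k\to B\overset{i}{\to}A\overset{\pi}{\to}L\to k,\qquad k\to B\overset{i'}{\to}A'\overset{\pi'}{\to}L\to k,$$ and a Hopf algebra map $\theta:A\to A'$ such that $\theta\circ i=i'$ and $\pi'\circ\theta=\pi$. Then $\theta$ is injective.
   Context: A sequence of Hopf algebra maps $k\to B\overset{i}{\to}A\overset{p}{\to}L\to k$ is called pre-exact if $i$ is injective, $p$ is surjective, and $i(B)=A^{co\,p}$, where $$A^{co\,p}=\{a\in A\mid (\mathrm{id}\otimes p)\Delta(a)=a\otimes 1\}.$$ A Hopf algebra is cosemisimple if every comodule over it is a direct sum of simple comodules. *)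

theory Defs
  imports Complex_Main "HOL-Library.Function_Algebras"
begin

definition pointwise :: "('k \<Rightarrow> 'v \<Rightarrow> 'v) \<Rightarrow> 'k \<Rightarrow> ('x \<Rightarrow> 'v) \<Rightarrow> 'x \<Rightarrow> 'v"
  where "pointwise s c f = (\<lambda>x. s c (f x))"

text \<open>
  Tensor products over a field \<open>k\<close>. An element of \<open>V \<otimes> W\<close> is represented by the functional it
  induces on the space of all bilinear forms on \<open>V \<times> W\<close>; functionals are extended by \<open>0\<close> to arbitrary
  functions of two arguments. Since \<open>k\<close> is a field, this embeds \<open>V \<otimes> W\<close> in the dual of the space of
  bilinear forms, with image the span of the evaluations \<open>v \<otimes> w\<close>. Addition is pointwise and the
  scalar multiplication is \<^term>\<open>pointwise (*)\<close>. The universal property is lemma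
  \<open>tensor_lift_eq\<close> below.
\<close>

type_synonym ('v, 'w, 'k) tensor = "('v \<Rightarrow> 'w \<Rightarrow> 'k) \<Rightarrow> 'k"

definition bilinear_form ::
    "('k::field \<Rightarrow> 'v::ab_group_add \<Rightarrow> 'v) \<Rightarrow> ('k \<Rightarrow> 'w::ab_group_add \<Rightarrow> 'w) \<Rightarrow> ('v \<Rightarrow> 'w \<Rightarrow> 'k) \<Rightarrow> bool"
  where "bilinear_form s1 s2 \<beta> \<longleftrightarrow>
    (\<forall>v. Vector_Spaces.linear s2 (*) (\<lambda>w. \<beta> v w)) \<and> (\<forall>w. Vector_Spaces.linear s1 (*) (\<lambda>v. \<beta> v w))"

definition tensor ::
    "('k::field \<Rightarrow> 'v::ab_group_add \<Rightarrow> 'v) \<Rightarrow> ('k \<Rightarrow> 'w::ab_group_add \<Rightarrow> 'w) \<Rightarrow> 'v \<Rightarrow> 'w \<Rightarrow> ('v, 'w, 'k) tensor"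
  where "tensor s1 s2 v w = (\<lambda>\<beta>. if bilinear_form s1 s2 \<beta> then \<beta> v w else 0)"

text \<open>For subspaces \<open>V\<close>, \<open>W\<close> the space \<open>V \<otimes> W\<close> is a subspace of the tensor product of the
  ambient spaces (again because \<open>k\<close> is a field).\<close>

definition tensor_space ::
    "('k::field \<Rightarrow> 'v::ab_group_add \<Rightarrow> 'v) \<Rightarrow> ('k \<Rightarrow> 'w::ab_group_add \<Rightarrow> 'w) \<Rightarrow>
      'v set \<Rightarrow> 'w set \<Rightarrow> ('v, 'w, 'k) tensor set"
  where "tensor_space s1 s2 V W =
    module.span (pointwise (*)) {tensor s1 s2 v w | v w. v \<in> V \<and> w \<in> W}"

text \<open>The linear map \<open>V \<otimes> W \<rightarrow> X\<close> induced by a map \<open>f\<close> that is bilinear on \<open>V \<times> W\<close>, that is,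
  \<open>\<Sum>i. v\<^sub>i \<otimes> w\<^sub>i \<mapsto> \<Sum>i. f v\<^sub>i w\<^sub>i\<close>.\<close>

definition tensor_lift ::
    "('k::field \<Rightarrow> 'v::ab_group_add \<Rightarrow> 'v) \<Rightarrow> ('k \<Rightarrow> 'w::ab_group_add \<Rightarrow> 'w) \<Rightarrow>
      'v set \<Rightarrow> 'w set \<Rightarrow> ('v \<Rightarrow> 'w \<Rightarrow> 'x::ab_group_add) \<Rightarrow> ('v, 'w, 'k) tensor \<Rightarrow> 'x"
  where "tensor_lift s1 s2 V W f t =
    (THE x. \<exists>ps. set ps \<subseteq> V \<times> W \<and> t = (\<Sum>(v, w)\<leftarrow>ps. tensor s1 s2 v w) \<and> x = (\<Sum>(v, w)\<leftarrow>ps. f v w))"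

text \<open>The image of \<open>t \<otimes> w\<close>, for \<open>t \<in> U \<otimes> V\<close>, under the associativity isomorphism
  \<open>(U \<otimes> V) \<otimes> W \<cong> U \<otimes> (V \<otimes> W)\<close>.\<close>

definition tensor_assoc ::
    "('k::field \<Rightarrow> 'u::ab_group_add \<Rightarrow> 'u) \<Rightarrow> ('k \<Rightarrow> 'v::ab_group_add \<Rightarrow> 'v) \<Rightarrow>
      ('k \<Rightarrow> 'w::ab_group_add \<Rightarrow> 'w) \<Rightarrow> 'u set \<Rightarrow> 'v set \<Rightarrow>
      ('u, 'v, 'k) tensor \<Rightarrow> 'w \<Rightarrow> ('u, ('v, 'w, 'k) tensor, 'k) tensor"
  where "tensor_assoc s1 s2 s3 U V t w =
    tensor_lift s1 s2 U V (\<lambda>u v. tensor s1 (pointwise (*)) u (tensor s2 s3 v w)) t"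

text \<open>The linear map \<open>f \<otimes> g\<close>.\<close>

definition tensor_map ::
    "('k::field \<Rightarrow> 'v::ab_group_add \<Rightarrow> 'v) \<Rightarrow> ('k \<Rightarrow> 'w::ab_group_add \<Rightarrow> 'w) \<Rightarrow>
      ('k \<Rightarrow> 'x::ab_group_add \<Rightarrow> 'x) \<Rightarrow> ('k \<Rightarrow> 'y::ab_group_add \<Rightarrow> 'y) \<Rightarrow>
      ('v \<Rightarrow> 'x) \<Rightarrow> ('w \<Rightarrow> 'y) \<Rightarrow> ('v, 'w, 'k) tensor \<Rightarrow> ('x, 'y, 'k) tensor"
  where "tensor_map s1 s2 s3 s4 f g = tensor_lift s1 s2 UNIV UNIV (\<lambda>v w. tensor s3 s4 (f v) (g w))"

lemma vector_space_pointwise: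
  assumes "vector_space s"
  shows "vector_space (pointwise s)"
proof -
  interpret vector_space s by fact
  show ?thesis
    by unfold_locales (simp_all add: pointwise_def fun_eq_iff scale_right_distrib scale_left_distrib)
qed

lemma vector_space_field: "vector_space ((*) :: 'k::field \<Rightarrow> 'k \<Rightarrow> 'k)"
  by unfold_locales (simp_all add: distrib_left distrib_right mult.assoc)

lemma sum_list_fun_apply: "(\<Sum>x\<leftarrow>xs. F x) \<beta> = (\<Sum>x\<leftarrow>xs. F x \<beta>)"
  by (induction xs) auto

lemma linear_sum_list:
  assumes "Vector_Spaces.linear s1 s2 \<phi>"
  shows "\<phi> (\<Sum>x\<leftarrow>xs. F x) = (\<Sum>x\<leftarrow>xs. \<phi> (F x))"
proof -
  interpret Vector_Spaces.linear s1 s2 \<phi> by fact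
  show ?thesis by (induction xs) (simp_all add: zero add)
qed

lemma exists_projection:
  assumes "vector_space s" "module.subspace s V"
  shows "\<exists>P. range P \<subseteq> V \<and> Vector_Spaces.linear s s P \<and> (\<forall>v\<in>V. P v = v)"
proof -
  interpret vector_space s by fact
  interpret vector_space_pair s s by unfold_locales
  show ?thesis
    using linear_exists_left_inverse_on[OF linear_id assms(2)]
    by (simp add: inj_on_def)
qed

lemma exists_functional:
  fixes s :: "'a::field \<Rightarrow> 'b::ab_group_add \<Rightarrow> 'b"
  assumes "vector_space s" "x \<noteq> 0"
  shows "\<exists>\<phi>. Vector_Spaces.linear s (*) \<phi> \<and> \<phi> x \<noteq> 0"
proof -
  interpret vector_space s by fact
  have pair: "vector_space_pair s ((*) :: 'a \<Rightarrow> 'a \<Rightarrow> 'a)"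
    using assms(1) vector_space_field by (rule vector_space_pair.intro)
  have "\<not> dependent {x}" using assms(2) by simp
  from vector_space_pair.linear_independent_extend[OF pair this, of "\<lambda>_. 1"]
  obtain \<phi> where "Vector_Spaces.linear s (*) \<phi>" "\<phi> x = 1" by auto
  then show ?thesis by (intro exI[of _ \<phi>]) simp
qed

lemma tensor_lift_eq:
  assumes "vector_space s1" "vector_space s2" "vector_space s3"
    and "module.subspace s1 V" "module.subspace s2 W"
    and add_left: "\<And>v v' w. v \<in> V \<Longrightarrow> v' \<in> V \<Longrightarrow> w \<in> W \<Longrightarrow> f (v + v') w = f v w + f v' w"
    and add_right: "\<And>v w w'. v \<in> V \<Longrightarrow> w \<in> W \<Longrightarrow> w' \<in> W \<Longrightarrow> f v (w + w') = f v w + f v w'"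
    and scale_left: "\<And>c v w. v \<in> V \<Longrightarrow> w \<in> W \<Longrightarrow> f (s1 c v) w = s3 c (f v w)"
    and scale_right: "\<And>c v w. v \<in> V \<Longrightarrow> w \<in> W \<Longrightarrow> f v (s2 c w) = s3 c (f v w)"
    and ps: "set ps \<subseteq> V \<times> W"
  shows "tensor_lift s1 s2 V W f (\<Sum>(v, w)\<leftarrow>ps. tensor s1 s2 v w) = (\<Sum>(v, w)\<leftarrow>ps. f v w)"
proof -
  obtain P where P: "range P \<subseteq> V" "Vector_Spaces.linear s1 s1 P" "\<forall>v\<in>V. P v = v"
    using exists_projection[OF assms(1,4)] by (elim exE conjE)
  obtain Q where Q: "range Q \<subseteq> W" "Vector_Spaces.linear s2 s2 Q" "\<forall>w\<in>W. Q w = w"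
    using exists_projection[OF assms(2,5)] by (elim exE conjE)
  have eq: "(\<Sum>(v, w)\<leftarrow>qs. f v w) = (\<Sum>(v, w)\<leftarrow>ps. f v w)"
    if qs: "set qs \<subseteq> V \<times> W"
      and t: "(\<Sum>(v, w)\<leftarrow>ps. tensor s1 s2 v w) = (\<Sum>(v, w)\<leftarrow>qs. tensor s1 s2 v w)" for qs
  proof (rule ccontr)
    assume "\<not> ?thesis"
    then obtain \<phi> where \<phi>: "Vector_Spaces.linear s3 (*) \<phi>"
      and ne: "\<phi> ((\<Sum>(v, w)\<leftarrow>qs. f v w) - (\<Sum>(v, w)\<leftarrow>ps. f v w)) \<noteq> 0"
      using exists_functional[OF assms(3)] right_minus_eq by blast
    define \<beta> where "\<beta> v w = \<phi> (f (P v) (Q w))" for v w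
    have [simp]: "P v \<in> V" "Q w \<in> W" for v w using P(1) Q(1) by auto
    have \<beta>: "bilinear_form s1 s2 \<beta>"
      using P(2) Q(2) \<phi> vector_space_field assms(1,2)
      unfolding bilinear_form_def Vector_Spaces.linear_iff \<beta>_def
      by (simp add: add_left add_right scale_left scale_right)
    have val: "(\<Sum>(v, w)\<leftarrow>rs. tensor s1 s2 v w) \<beta> = \<phi> (\<Sum>(v, w)\<leftarrow>rs. f v w)"
      if "set rs \<subseteq> V \<times> W" for rs
      unfolding sum_list_fun_apply linear_sum_list[OF \<phi>]
      using that P(3) Q(3)
      by (intro arg_cong[where f = sum_list] map_cong) (auto simp: tensor_def \<beta> \<beta>_def)
    have "\<phi> (\<Sum>(v, w)\<leftarrow>qs. f v w) = \<phi> (\<Sum>(v, w)\<leftarrow>ps. f v w)"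
      using val[OF qs] val[OF ps] t by simp
    then show False
      using ne module_hom.diff[OF \<phi>[folded module_hom_iff_linear]] by simp
  qed
  show ?thesis
    unfolding tensor_lift_def by (rule the_equality) (use ps eq in blast)+
qed


text \<open>
  The carrier of a Hopf algebra is a whole type, whose ring structure is that of class
  \<^class>\<open>ring_1\<close>. The requirement \<open>0 \<noteq> 1\<close> of that class holds in every Hopf algebra over a field,
  because the counit maps \<open>1\<close> to \<open>1\<close>.
\<close>

record ('k, 'h) hopf_data =
  scale :: "'k \<Rightarrow> 'h \<Rightarrow> 'h"
  comult :: "'h \<Rightarrow> ('h, 'h, 'k) tensor"
  counit :: "'h \<Rightarrow> 'k"
  antipode :: "'h \<Rightarrow> 'h"

definition k_algebra :: "('k::field, 'h::ring_1) hopf_data \<Rightarrow> bool"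
  where "k_algebra H \<longleftrightarrow> vector_space (scale H) \<and>
    (\<forall>c x y. scale H c x * y = scale H c (x * y) \<and> x * scale H c y = scale H c (x * y))"

definition coalgebra :: "('k::field, 'h::ring_1) hopf_data \<Rightarrow> bool"
  where "coalgebra H \<longleftrightarrow>
    Vector_Spaces.linear (scale H) (pointwise (*)) (comult H) \<and>
    range (comult H) \<subseteq> tensor_space (scale H) (scale H) UNIV UNIV \<and>
    Vector_Spaces.linear (scale H) (*) (counit H) \<and>
    (\<forall>h. tensor_lift (scale H) (scale H) UNIV UNIV
            (\<lambda>a b. tensor_assoc (scale H) (scale H) (scale H) UNIV UNIV (comult H a) b) (comult H h)
        = tensor_lift (scale H) (scale H) UNIV UNIV
            (\<lambda>a b. tensor (scale H) (pointwise (*)) a (comult H b)) (comult H h)) \<and>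
    (\<forall>h. tensor_lift (scale H) (scale H) UNIV UNIV (\<lambda>a b. scale H (counit H a) b) (comult H h) = h) \<and>
    (\<forall>h. tensor_lift (scale H) (scale H) UNIV UNIV (\<lambda>a b. scale H (counit H b) a) (comult H h) = h)"

definition tensor_mult ::
    "('k::field, 'h::ring_1) hopf_data \<Rightarrow> ('h, 'h, 'k) tensor \<Rightarrow> ('h, 'h, 'k) tensor \<Rightarrow> ('h, 'h, 'k) tensor"
  where "tensor_mult H t u =
    tensor_lift (scale H) (scale H) UNIV UNIV (\<lambda>a b.
      tensor_lift (scale H) (scale H) UNIV UNIV (\<lambda>c d.
        tensor (scale H) (scale H) (a * c) (b * d)) u) t"

definition bialgebra :: "('k::field, 'h::ring_1) hopf_data \<Rightarrow> bool"
  where "bialgebra H \<longleftrightarrow> k_algebra H \<and> coalgebra H \<and>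
    comult H 1 = tensor (scale H) (scale H) 1 1 \<and>
    (\<forall>x y. comult H (x * y) = tensor_mult H (comult H x) (comult H y)) \<and>
    counit H 1 = 1 \<and>
    (\<forall>x y. counit H (x * y) = counit H x * counit H y)"

definition hopf_algebra :: "('k::field, 'h::ring_1) hopf_data \<Rightarrow> bool"
  where "hopf_algebra H \<longleftrightarrow> bialgebra H \<and>
    Vector_Spaces.linear (scale H) (scale H) (antipode H) \<and>
    (\<forall>h. tensor_lift (scale H) (scale H) UNIV UNIV (\<lambda>a b. antipode H a * b) (comult H h)
        = scale H (counit H h) 1) \<and>
    (\<forall>h. tensor_lift (scale H) (scale H) UNIV UNIV (\<lambda>a b. a * antipode H b) (comult H h)
        = scale H (counit H h) 1)"

definition hopf_map ::
    "('k::field, 'g::ring_1) hopf_data \<Rightarrow> ('k, 'h::ring_1) hopf_data \<Rightarrow> ('g \<Rightarrow> 'h) \<Rightarrow> bool"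
  where "hopf_map G H f \<longleftrightarrow>
    Vector_Spaces.linear (scale G) (scale H) f \<and>
    f 1 = 1 \<and> (\<forall>x y. f (x * y) = f x * f y) \<and>
    (\<forall>x. comult H (f x) = tensor_map (scale G) (scale G) (scale H) (scale H) f f (comult G x)) \<and>
    (\<forall>x. counit H (f x) = counit G x) \<and>
    (\<forall>x. f (antipode G x) = antipode H (f x))"

definition coinvariants ::
    "('k::field, 'a::ring_1) hopf_data \<Rightarrow> ('k, 'l::ring_1) hopf_data \<Rightarrow> ('a \<Rightarrow> 'l) \<Rightarrow> 'a set"
  where "coinvariants A L p =
    {a. tensor_map (scale A) (scale A) (scale A) (scale L) id p (comult A a)
        = tensor (scale A) (scale L) a 1}"

definition pre_exact ::
    "('k::field, 'b::ring_1) hopf_data \<Rightarrow> ('k, 'a::ring_1) hopf_data \<Rightarrow> ('k, 'l::ring_1) hopf_data \<Rightarrow>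
      ('b \<Rightarrow> 'a) \<Rightarrow> ('a \<Rightarrow> 'l) \<Rightarrow> bool"
  where "pre_exact B A L i p \<longleftrightarrow>
    hopf_map B A i \<and> hopf_map A L p \<and> inj i \<and> surj p \<and> range i = coinvariants A L p"


text \<open>A right \<open>H\<close>-comodule whose underlying space is a subspace \<open>V\<close> of an ambient space with scalar
  multiplication \<open>s\<close>; the values of \<open>\<rho>\<close> outside \<open>V\<close> are irrelevant.\<close>

definition comodule ::
    "('k::field \<Rightarrow> 'v::ab_group_add \<Rightarrow> 'v) \<Rightarrow> ('k, 'h::ring_1) hopf_data \<Rightarrow>
      'v set \<Rightarrow> ('v \<Rightarrow> ('v, 'h, 'k) tensor) \<Rightarrow> bool"
  where "comodule s H V \<rho> \<longleftrightarrow>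
    vector_space s \<and> module.subspace s V \<and>
    (\<forall>x\<in>V. \<forall>y\<in>V. \<rho> (x + y) = \<rho> x + \<rho> y) \<and>
    (\<forall>c. \<forall>x\<in>V. \<rho> (s c x) = pointwise (*) c (\<rho> x)) \<and>
    \<rho> ` V \<subseteq> tensor_space s (scale H) V UNIV \<and>
    (\<forall>x\<in>V. tensor_lift s (scale H) V UNIV
              (\<lambda>v h. tensor_assoc s (scale H) (scale H) V UNIV (\<rho> v) h) (\<rho> x)
          = tensor_lift s (scale H) V UNIV
              (\<lambda>v h. tensor s (pointwise (*)) v (comult H h)) (\<rho> x)) \<and>
    (\<forall>x\<in>V. tensor_lift s (scale H) V UNIV (\<lambda>v h. s (counit H h) v) (\<rho> x) = x)"

text \<open>A subset \<open>W \<subseteq> V\<close> is a subcomodule of \<open>(V, \<rho>)\<close> iff \<open>(W, \<rho>)\<close> is itself a comodule.\<close>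

definition simple_comodule ::
    "('k::field \<Rightarrow> 'v::ab_group_add \<Rightarrow> 'v) \<Rightarrow> ('k, 'h::ring_1) hopf_data \<Rightarrow>
      'v set \<Rightarrow> ('v \<Rightarrow> ('v, 'h, 'k) tensor) \<Rightarrow> bool"
  where "simple_comodule s H V \<rho> \<longleftrightarrow>
    comodule s H V \<rho> \<and> V \<noteq> {0} \<and> (\<forall>W\<subseteq>V. comodule s H W \<rho> \<longrightarrow> W = {0} \<or> W = V)"

definition internal_direct_sum ::
    "('k::field \<Rightarrow> 'v::ab_group_add \<Rightarrow> 'v) \<Rightarrow> 'v set set \<Rightarrow> 'v set \<Rightarrow> bool"
  where "internal_direct_sum s F V \<longleftrightarrow>
    (\<forall>W\<in>F. module.subspace s W) \<and> module.span s (\<Union>F) = V \<and>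
    (\<forall>W\<in>F. W \<inter> module.span s (\<Union>(F - {W})) = {0})"

text \<open>
  HOL cannot quantify over all types inside a formula, so the comodules in question are those carried
  by subspaces of the space of all sequences in \<open>H\<close>. Up to isomorphism these include all
  finite-dimensional comodules and \<open>H\<close> itself. As every comodule is the sum of its
  finite-dimensional subcomodules, every comodule of any size is a direct sum of simple ones as soon
  as this holds for the comodules considered here.
\<close>

definition cosemisimple :: "('k::field, 'h::ring_1) hopf_data \<Rightarrow> bool"
  where "cosemisimple H \<longleftrightarrow>
    (\<forall>(V :: (nat \<Rightarrow> 'h) set) \<rho>. comodule (pointwise (scale H)) H V \<rho> \<longrightarrow>
      (\<exists>F. (\<forall>W\<in>F. simple_comodule (pointwise (scale H)) H W \<rho>) \<and>
           internal_direct_sum (pointwise (scale H)) F V))"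

end

theory Submission
  imports Defs
begin

text \<open>
  The theorem reduces to a statement about one Hopf algebra map: a map \<open>f\<close> between cosemisimple Hopf
  algebras whose only coinvariants are the scalars is injective (\<open>inj_if_trivial_coinvariants\<close>).

  The reduction is short. If \<open>a\<close> is coinvariant for \<open>\<theta>\<close>, it is coinvariant for \<open>\<pi> = \<pi>' \<circ> \<theta>\<close>, so
  \<open>a = i b\<close> by exactness at \<open>A\<close>. Applying the counit to the first leg of
  \<open>a\<^sub>1 \<otimes> \<theta> a\<^sub>2 = a \<otimes> 1\<close> gives \<open>\<theta> a = \<epsilon>(a) 1\<close>, that is, \<open>i' b = i' (\<epsilon>(a) 1)\<close>. As \<open>i'\<close> is
  injective, \<open>b\<close> and hence \<open>a\<close> is a scalar.

  For the injectivity criterion, cosemisimplicity enters through the Haar functional: the scalars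
  split off the regular comodule, and the projection onto them is a linear form \<open>h\<close> with \<open>h 1 = 1\<close> and
  \<open>h(a\<^sub>1) a\<^sub>2 = h(a) 1\<close> (\<open>cosemisimple_haar\<close>). Two facts about Haar functionals finish the proof.
  \<^item> A Haar functional is faithful: if \<open>h (S x * y) = 0\<close> for all \<open>y\<close>, then \<open>x = 0\<close>
    (\<open>haar_faithful\<close>). In particular the antipode of a Hopf algebra with a Haar functional is injective.
  \<^item> If \<open>h\<close> is a Haar functional on the target of \<open>f\<close>, the map \<open>a \<mapsto> S (h(f a\<^sub>1) a\<^sub>2)\<close> takes
    values in the coinvariants of \<open>f\<close>. If these are the scalars and the antipode of the source is
    injective, it follows that \<open>h \<circ> f\<close> is a Haar functional on the source (\<open>haar_pullback\<close>).

  If \<open>f x = 0\<close>, then \<open>h (f (S x * y)) = 0\<close> for all \<open>y\<close>, and faithfulness of \<open>h \<circ> f\<close> gives \<open>x = 0\<close>.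
\<close>

section \<open>Tensors as sums of pure tensors\<close>

lemma pointwise_apply: "pointwise s c f x = s c (f x)"
  by (simp add: pointwise_def)

lemma field_linear_iff:
  assumes "vector_space s"
  shows "Vector_Spaces.linear s (*) \<phi> \<longleftrightarrow> (\<forall>x y. \<phi> (x + y) = \<phi> x + \<phi> y) \<and> (\<forall>c x. \<phi> (s c x) = c * \<phi> x)"
  using assms vector_space_field by (auto simp: Vector_Spaces.linear_iff)

lemma bilinear_form_iff:
  assumes "vector_space s1" "vector_space s2"
  shows "bilinear_form s1 s2 \<beta> \<longleftrightarrow>
    (\<forall>u v w. \<beta> (u + v) w = \<beta> u w + \<beta> v w) \<and> (\<forall>u v w. \<beta> u (v + w) = \<beta> u v + \<beta> u w) \<and>
    (\<forall>c u w. \<beta> (s1 c u) w = c * \<beta> u w) \<and> (\<forall>c u w. \<beta> u (s2 c w) = c * \<beta> u w)"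
  using assms unfolding bilinear_form_def by (auto simp: field_linear_iff)

lemma tensor_add_left:
  assumes "vector_space s1" "vector_space s2"
  shows "tensor s1 s2 (u + v) w = tensor s1 s2 u w + tensor s1 s2 v w"
  by (auto simp: tensor_def fun_eq_iff bilinear_form_iff assms)

lemma tensor_add_right:
  assumes "vector_space s1" "vector_space s2"
  shows "tensor s1 s2 u (v + w) = tensor s1 s2 u v + tensor s1 s2 u w"
  by (auto simp: tensor_def fun_eq_iff bilinear_form_iff assms)

lemma tensor_scale_left:
  assumes "vector_space s1" "vector_space s2"
  shows "tensor s1 s2 (s1 c u) w = pointwise (*) c (tensor s1 s2 u w)"
  by (auto simp: tensor_def pointwise_def fun_eq_iff bilinear_form_iff assms)

lemma tensor_scale_right:
  assumes "vector_space s1" "vector_space s2"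
  shows "tensor s1 s2 u (s2 c w) = pointwise (*) c (tensor s1 s2 u w)"
  by (auto simp: tensor_def pointwise_def fun_eq_iff bilinear_form_iff assms)

abbreviation tensor_sum where
  "tensor_sum s1 s2 ps \<equiv> (\<Sum>(v, w)\<leftarrow>ps. tensor s1 s2 v w)"

lemma vector_space_tensor: "vector_space (pointwise ((*) :: 'k::field \<Rightarrow> 'k \<Rightarrow> 'k))"
  using vector_space_field by (rule vector_space_pointwise)

lemma tensor_space_imp_list:
  fixes s1 :: "'a::field \<Rightarrow> 'b::ab_group_add \<Rightarrow> 'b" and s2 :: "'a \<Rightarrow> 'c::ab_group_add \<Rightarrow> 'c"
  assumes vs: "vector_space s1" "vector_space s2" and V: "module.subspace s1 V"
    and t: "t \<in> tensor_space s1 s2 V W"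
  obtains ps where "set ps \<subseteq> V \<times> W" "t = tensor_sum s1 s2 ps"
proof -
  interpret T: vector_space "pointwise (*) :: 'a \<Rightarrow> (('b \<Rightarrow> 'c \<Rightarrow> 'a) \<Rightarrow> 'a) \<Rightarrow> _"
    by (rule vector_space_tensor)
  interpret V: vector_space s1 by (rule vs)
  have "\<exists>ps. set ps \<subseteq> V \<times> W \<and> t = tensor_sum s1 s2 ps"
    using t unfolding tensor_space_def
  proof (induction rule: T.span_induct_alt)
    case base
    then show ?case by (intro exI[of _ "[]"]) simp
  next
    case (step c x y)
    then obtain v w ps where "v \<in> V" "w \<in> W" "x = tensor s1 s2 v w" "set ps \<subseteq> V \<times> W"
      "y = tensor_sum s1 s2 ps" by auto
    then show ?case using V.subspace_scale[OF V]
      by (intro exI[of _ "(s1 c v, w) # ps"]) (simp add: tensor_scale_left[OF vs])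
  qed
  then show ?thesis using that by blast
qed

lemma tensor_sum_apply:
  "tensor_sum s1 s2 ps \<beta> = (if bilinear_form s1 s2 \<beta> then (\<Sum>(v, w)\<leftarrow>ps. \<beta> v w) else 0)"
  by (induction ps) (auto simp: tensor_def)

lemma tensor_sum_eq_iff:
  "tensor_sum s1 s2 ps = tensor_sum s1 s2 qs \<longleftrightarrow>
    (\<forall>\<beta>. bilinear_form s1 s2 \<beta> \<longrightarrow> (\<Sum>(v, w)\<leftarrow>ps. \<beta> v w) = (\<Sum>(v, w)\<leftarrow>qs. \<beta> v w))"
  unfolding fun_eq_iff tensor_sum_apply by auto

lemma tensor_sum_in_tensor_space:
  fixes s1 :: "'a::field \<Rightarrow> 'b::ab_group_add \<Rightarrow> 'b" and s2 :: "'a \<Rightarrow> 'c::ab_group_add \<Rightarrow> 'c"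
  assumes "set ps \<subseteq> V \<times> W"
  shows "tensor_sum s1 s2 ps \<in> tensor_space s1 s2 V W"
proof -
  interpret T: vector_space "pointwise (*) :: 'a \<Rightarrow> (('b \<Rightarrow> 'c \<Rightarrow> 'a) \<Rightarrow> 'a) \<Rightarrow> _"
    by (rule vector_space_tensor)
  show ?thesis using assms
    unfolding tensor_space_def
    by (induction ps) (auto intro!: T.span_add[OF T.span_base] T.span_zero)
qed

section \<open>Sweedler sums\<close>

text \<open>
  \<open>sweedler H f x\<close> is Sweedler's \<open>f x\<^sub>1 x\<^sub>2\<close>, summed over one chosen list that represents the
  comultiplication of \<open>x\<close>. With a fixed list the sum is additive in \<open>f\<close>, and two such sums commute,
  for arbitrary \<open>f\<close>; for bilinear \<open>f\<close> the sum is moreover independent of the list and linear in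
  \<open>x\<close>.
\<close>

definition sweedler :: "('k::field, 'h::ring_1) hopf_data \<Rightarrow> ('h \<Rightarrow> 'h \<Rightarrow> 'x::ab_group_add) \<Rightarrow> 'h \<Rightarrow> 'x"
  where "sweedler H f x =
    (\<Sum>(u, v)\<leftarrow>(SOME ps. comult H x = tensor_sum (scale H) (scale H) ps). f u v)"

lemma sweedler_add: "sweedler H (\<lambda>u v. f u v + g u v) x = sweedler H f x + sweedler H g x"
  unfolding sweedler_def by (simp add: split_def sum_list_addf)

lemma sweedler_mult_left:
  fixes f :: "'h::ring_1 \<Rightarrow> 'h \<Rightarrow> 'a::ring"
  shows "sweedler H (\<lambda>u v. c * f u v) x = c * sweedler H f x"
  unfolding sweedler_def by (simp add: split_def sum_list_const_mult)

lemma sweedler_zero [simp]: "sweedler H (\<lambda>u v. 0) x = 0"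
  unfolding sweedler_def by (simp add: split_def)

lemma sweedler_swap:
  fixes f :: "_ \<Rightarrow> _ \<Rightarrow> _ \<Rightarrow> _ \<Rightarrow> 'x::ab_group_add"
  shows "sweedler H (\<lambda>u v. sweedler G (\<lambda>a b. f u v a b) y) x = sweedler G (\<lambda>a b. sweedler H (\<lambda>u v. f u v a b) x) y"
proof -
  have *: "(\<Sum>p\<leftarrow>ps. \<Sum>q\<leftarrow>qs. F p q) = (\<Sum>q\<leftarrow>qs. \<Sum>p\<leftarrow>ps. F p q)"
    for ps :: "'p list" and qs :: "'q list" and F :: "'p \<Rightarrow> 'q \<Rightarrow> 'x"
    by (induction ps) (simp_all add: sum_list_addf)
  show ?thesis unfolding sweedler_def split_def by (rule *)
qed

lemma linear_sweedler:
  assumes "Vector_Spaces.linear s1 s2 \<phi>"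
  shows "\<phi> (sweedler H f x) = sweedler H (\<lambda>u v. \<phi> (f u v)) x"
  unfolding sweedler_def linear_sum_list[OF assms] by (simp add: split_def)

locale hopf =
  fixes H :: "('k::field, 'h::ring_1) hopf_data"
  assumes hopf: "hopf_algebra H"
begin

abbreviation "sc \<equiv> scale H"
abbreviation "\<epsilon> \<equiv> counit H"
abbreviation "S \<equiv> antipode H"
abbreviation "sw \<equiv> sweedler H"

lemma bialgebra_laws: "k_algebra H" "coalgebra H" "comult H 1 = tensor sc sc 1 1" "\<epsilon> 1 = 1"
    "comult H (x * y) = tensor_mult H (comult H x) (comult H y)" "\<epsilon> (x * y) = \<epsilon> x * \<epsilon> y"
  using hopf unfolding hopf_algebra_def bialgebra_def by blast+

lemma vs: "vector_space sc" 
  using bialgebra_laws(1) unfolding k_algebra_def by blast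

sublocale vector_space sc by (rule vs)

lemma mult_scale: "sc c x * y = sc c (x * y)" "x * sc c y = sc c (x * y)"
  using bialgebra_laws(1) unfolding k_algebra_def by blast+

lemma linear_comult: "Vector_Spaces.linear sc (pointwise (*)) (comult H)"
  and linear_counit: "Vector_Spaces.linear sc (*) \<epsilon>"
  using bialgebra_laws(2) unfolding coalgebra_def by blast+

lemma linear_antipode: "Vector_Spaces.linear sc sc S"
  using hopf unfolding hopf_algebra_def by blast

lemma counit_linear: "\<epsilon> (x + y) = \<epsilon> x + \<epsilon> y" "\<epsilon> (sc c x) = c * \<epsilon> x"
  using linear_counit unfolding field_linear_iff[OF vs] by blast+

lemma antipode_linear: "S (x + y) = S x + S y" "S (sc c x) = sc c (S x)"
  using linear_antipode unfolding Vector_Spaces.linear_iff by blast+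

lemmas form_iff = field_linear_iff[OF vs] bilinear_form_iff[OF vs vs]

lemma exists_sweedler_list: "\<exists>ps. comult H x = tensor_sum sc sc ps"
proof -
  have "comult H x \<in> tensor_space sc sc UNIV UNIV"
    using bialgebra_laws(2) unfolding coalgebra_def by blast
  then show ?thesis using tensor_space_imp_list[OF vs vs subspace_UNIV] by metis
qed

lemma sweedler_list:
  assumes "bilinear_form sc sc \<beta>" "comult H x = tensor_sum sc sc ps"
  shows "sw \<beta> x = (\<Sum>(u, v)\<leftarrow>ps. \<beta> u v)"
proof -
  have "comult H x = tensor_sum sc sc (SOME ps. comult H x = tensor_sum sc sc ps)"
    using someI_ex[OF exists_sweedler_list] .
  then have "tensor_sum sc sc (SOME ps. comult H x = tensor_sum sc sc ps) = tensor_sum sc sc ps"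
    unfolding assms(2) by (rule sym)
  then show ?thesis unfolding sweedler_def tensor_sum_eq_iff using assms(1) by blast
qed

lemma sweedler_eval: "bilinear_form sc sc \<beta> \<Longrightarrow> sw \<beta> x = comult H x \<beta>"
  using sweedler_list exists_sweedler_list by (metis tensor_sum_apply)

lemma sweedler_linear:
  assumes "bilinear_form sc sc \<beta>"
  shows "sw \<beta> (x + y) = sw \<beta> x + sw \<beta> y" "sw \<beta> (sc c x) = c * sw \<beta> x"
  using linear_comult assms
  by (simp_all add: sweedler_eval Vector_Spaces.linear_iff pointwise_def)

text \<open>
  The axioms about the comultiplication are equations between maps induced on a tensor product; this
  turns them into equations of Sweedler sums.
\<close>

lemma tensor_lift_comult:
  assumes "vector_space s3"
    and "\<And>v v' w. f (v + v') w = f v w + f v' w"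
    and "\<And>v w w'. f v (w + w') = f v w + f v w'"
    and "\<And>c v w. f (sc c v) w = s3 c (f v w)"
    and "\<And>c v w. f v (sc c w) = s3 c (f v w)"
  shows "tensor_lift sc sc UNIV UNIV f (comult H x) = sw f x"
proof -
  have "comult H x = tensor_sum sc sc (SOME ps. comult H x = tensor_sum sc sc ps)" (is "_ = tensor_sum _ _ ?ps")
    using someI_ex[OF exists_sweedler_list] .
  then have "tensor_lift sc sc UNIV UNIV f (comult H x) = tensor_lift sc sc UNIV UNIV f (tensor_sum sc sc ?ps)"
    by simp
  also have "\<dots> = (\<Sum>(u, v)\<leftarrow>?ps. f u v)"
    by (rule tensor_lift_eq[OF vs vs assms(1) subspace_UNIV subspace_UNIV]) (use assms in auto)
  finally show ?thesis by (simp add: sweedler_def)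
qed

lemma counit_left: "sw (\<lambda>a b. sc (\<epsilon> a) b) x = x"
proof -
  have "tensor_lift sc sc UNIV UNIV (\<lambda>a b. sc (\<epsilon> a) b) (comult H x) = x"
    using bialgebra_laws(2) unfolding coalgebra_def by blast
  then show ?thesis
    by (subst (asm) tensor_lift_comult[OF vs])
      (simp_all add: counit_linear scale_left_distrib scale_right_distrib mult.commute)
qed

lemma counit_right: "sw (\<lambda>a b. sc (\<epsilon> b) a) x = x"
proof -
  have "tensor_lift sc sc UNIV UNIV (\<lambda>a b. sc (\<epsilon> b) a) (comult H x) = x"
    using bialgebra_laws(2) unfolding coalgebra_def by blast
  then show ?thesis
    by (subst (asm) tensor_lift_comult[OF vs])
      (simp_all add: counit_linear scale_left_distrib scale_right_distrib mult.commute)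
qed

lemma antipode_left: "sw (\<lambda>a b. S a * b) x = sc (\<epsilon> x) 1"
proof -
  have "tensor_lift sc sc UNIV UNIV (\<lambda>a b. S a * b) (comult H x) = sc (\<epsilon> x) 1"
    using hopf unfolding hopf_algebra_def by blast
  then show ?thesis
    by (subst (asm) tensor_lift_comult[OF vs])
      (simp_all add: antipode_linear mult_scale algebra_simps)
qed

lemma antipode_right: "sw (\<lambda>a b. a * S b) x = sc (\<epsilon> x) 1"
proof -
  have "tensor_lift sc sc UNIV UNIV (\<lambda>a b. a * S b) (comult H x) = sc (\<epsilon> x) 1"
    using hopf unfolding hopf_algebra_def by blast
  then show ?thesis
    by (subst (asm) tensor_lift_comult[OF vs])
      (simp_all add: antipode_linear mult_scale algebra_simps)
qed

text \<open>
  Almost all computations below take place in the base field: a vector is known by its values under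
  linear forms, a tensor by its values under bilinear forms. For this reason the axioms are restated
  under an arbitrary linear form.
\<close>

lemma form_counit_left: "Vector_Spaces.linear sc (*) \<phi> \<Longrightarrow> sw (\<lambda>a b. \<epsilon> a * \<phi> b) x = \<phi> x"
  using linear_sweedler[of sc "(*)" \<phi> H "\<lambda>a b. sc (\<epsilon> a) b" x] by (simp add: counit_left form_iff)

lemma form_counit_right: "Vector_Spaces.linear sc (*) \<phi> \<Longrightarrow> sw (\<lambda>a b. \<phi> a * \<epsilon> b) x = \<phi> x"
  using linear_sweedler[of sc "(*)" \<phi> H "\<lambda>a b. sc (\<epsilon> b) a" x] by (simp add: counit_right form_iff mult.commute)

lemma form_antipode_left: "Vector_Spaces.linear sc (*) \<phi> \<Longrightarrow> sw (\<lambda>a b. \<phi> (S a * b)) x = \<epsilon> x * \<phi> 1"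
  using linear_sweedler[of sc "(*)" \<phi> H "\<lambda>a b. S a * b" x] by (simp add: antipode_left form_iff)

lemma form_antipode_right: "Vector_Spaces.linear sc (*) \<phi> \<Longrightarrow> sw (\<lambda>a b. \<phi> (a * S b)) x = \<epsilon> x * \<phi> 1"
  using linear_sweedler[of sc "(*)" \<phi> H "\<lambda>a b. a * S b" x] by (simp add: antipode_right form_iff)

lemma sweedler_one: "bilinear_form sc sc \<beta> \<Longrightarrow> sw \<beta> 1 = \<beta> 1 1"
  by (simp add: sweedler_eval bialgebra_laws tensor_def)

lemma sweedler_apply: "sw F x \<beta> = sw (\<lambda>u v. F u v \<beta>) x"
  unfolding sweedler_def sum_list_fun_apply by (simp add: split_def)

lemma sweedler_mult:
  assumes "bilinear_form sc sc \<beta>"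
  shows "sw \<beta> (x * y) = sw (\<lambda>a b. sw (\<lambda>c d. \<beta> (a * c) (b * d)) y) x"
proof -
  have inner: "tensor_lift sc sc UNIV UNIV (\<lambda>c d. tensor sc sc (a * c) (b * d)) (comult H y)
      = sw (\<lambda>c d. tensor sc sc (a * c) (b * d)) y" for a b
    by (rule tensor_lift_comult[OF vector_space_tensor])
      (simp_all add: algebra_simps mult_scale tensor_add_left tensor_add_right tensor_scale_left tensor_scale_right vs)
  have eval: "sw (\<lambda>c d. F c d) y = (\<lambda>\<beta>. sw (\<lambda>c d. F c d \<beta>) y)" for F :: "'h \<Rightarrow> 'h \<Rightarrow> ('h,'h,'k) tensor"
    by (simp add: fun_eq_iff sweedler_apply)
  have "comult H (x * y) = sw (\<lambda>a b. sw (\<lambda>c d. tensor sc sc (a * c) (b * d)) y) x"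
    unfolding bialgebra_laws(5) tensor_mult_def inner
    by (rule tensor_lift_comult[OF vector_space_tensor])
      (simp_all add: algebra_simps mult_scale tensor_add_left tensor_add_right tensor_scale_left tensor_scale_right vs
         sweedler_add, simp_all add: eval pointwise_def sweedler_mult_left)
  then show ?thesis using assms
    by (simp add: sweedler_eval sweedler_apply) (simp add: tensor_def)
qed

definition trilinear where
  "trilinear f \<longleftrightarrow> (\<forall>u v w z. f (u + v) w z = f u w z + f v w z) \<and>
    (\<forall>u v w z. f u (v + w) z = f u v z + f u w z) \<and>
    (\<forall>u v w z. f u v (w + z) = f u v w + f u v z) \<and>
    (\<forall>c u v w. f (sc c u) v w = c * f u v w) \<and> (\<forall>c u v w. f u (sc c v) w = c * f u v w) \<and>
    (\<forall>c u v w. f u v (sc c w) = (c :: 'k) * f u v w)"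

lemma trilinear_bilinear:
  assumes "trilinear f"
  shows "bilinear_form sc sc (f a)"
  using assms unfolding trilinear_def form_iff by auto

lemma coassoc_tensor:
  "sw (\<lambda>a b. sw (\<lambda>u v. tensor sc (pointwise (*)) u (tensor sc sc v b)) a) x =
   sw (\<lambda>a b. tensor sc (pointwise (*)) a (comult H b)) x"
proof -
  note t = vs vector_space_tensor tensor_add_left tensor_add_right tensor_scale_left tensor_scale_right
  have inner: "tensor_assoc sc sc sc UNIV UNIV (comult H a) b
     = sw (\<lambda>u v. tensor sc (pointwise (*)) u (tensor sc sc v b)) a" for a b
    unfolding tensor_assoc_def
    by (rule tensor_lift_comult[OF vector_space_tensor]) (simp_all add: t)
  have eval: "sw F y \<beta> = sw (\<lambda>c d. F c d \<beta>) y" for F :: "'h \<Rightarrow> 'h \<Rightarrow> ('h, ('h,'h,'k) tensor, 'k) tensor" and y \<beta>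
    by (rule sweedler_apply)
  have form: "bilinear_form sc sc (\<lambda>u v. tensor sc (pointwise (*)) u (tensor sc sc v b) \<beta>)" for b \<beta>
    by (simp add: form_iff t pointwise_apply)
  have t_eval: "tensor sc (pointwise (*)) u (tensor sc sc v (b + c)) \<beta> = tensor sc (pointwise (*)) u (tensor sc sc v b) \<beta> + tensor sc (pointwise (*)) u (tensor sc sc v c) \<beta>"
      "tensor sc (pointwise (*)) u (tensor sc sc v (sc k b)) \<beta> = k * tensor sc (pointwise (*)) u (tensor sc sc v b) \<beta>" for u v b c k \<beta>
    by (simp_all add: t pointwise_apply)
  have "sw (\<lambda>a b. sw (\<lambda>u v. tensor sc (pointwise (*)) u (tensor sc sc v b)) a) x =
      tensor_lift sc sc UNIV UNIV (\<lambda>a b. tensor_assoc sc sc sc UNIV UNIV (comult H a) b) (comult H x)"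
    unfolding inner
    by (rule tensor_lift_comult[OF vector_space_tensor, symmetric])
      (simp_all add: fun_eq_iff pointwise_apply eval form sweedler_linear sweedler_add sweedler_mult_left t_eval)
  also have "\<dots> = tensor_lift sc sc UNIV UNIV (\<lambda>a b. tensor sc (pointwise (*)) a (comult H b)) (comult H x)"
    using bialgebra_laws(2) unfolding coalgebra_def by blast
  also have "\<dots> = sw (\<lambda>a b. tensor sc (pointwise (*)) a (comult H b)) x"
    using linear_comult
    by (intro tensor_lift_comult[OF vector_space_tensor]) (simp_all add: t Vector_Spaces.linear_iff)
  finally show ?thesis .
qed

text \<open>
  To evaluate the two sides of coassociativity, elements of \<open>H \<otimes> (H \<otimes> H)\<close>, at a trilinear form, the form
  must become a bilinear form on the product of \<open>H\<close> with the whole type of functionals. A linear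
  projection of that type onto \<open>H \<otimes> H\<close> provides the extension.
\<close>

lemma coassoc:
  assumes f: "trilinear f"
  shows "sw (\<lambda>a b. sw (\<lambda>u v. f u v b) a) x = sw (\<lambda>a b. sw (\<lambda>u v. f a u v) b) x"
proof -
  let ?T = "tensor_space sc sc UNIV UNIV"
  interpret T: vector_space "pointwise (*) :: 'k \<Rightarrow> (('h \<Rightarrow> 'h \<Rightarrow> 'k) \<Rightarrow> 'k) \<Rightarrow> _"
    by (rule vector_space_tensor)
  have sub: "T.subspace ?T" unfolding tensor_space_def by (rule T.subspace_span)
  \<comment> \<open>\<open>\<beta> u t\<close> is \<open>t\<close>, projected to \<open>H \<otimes> H\<close>, evaluated at the bilinear form \<open>f u\<close>\<close>
  obtain P where P: "range P \<subseteq> ?T" "Vector_Spaces.linear (pointwise (*)) (pointwise (*)) P" "\<forall>v\<in>?T. P v = v"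
    using exists_projection[OF vector_space_tensor sub] by (elim exE conjE)
  define \<beta> where "\<beta> u t = P t (f u)" for u t
  have ev: "P t (f (u + u')) = P t (f u) + P t (f u')" "P t (f (sc c u)) = c * P t (f u)" for t u u' c
  proof -
    have "P t \<in> ?T" using P(1) by auto
    then obtain ps where "P t = tensor_sum sc sc ps"
      using tensor_space_imp_list[OF vs vs subspace_UNIV] by metis
    moreover have "(\<Sum>p\<leftarrow>ps. f (u + u') (fst p) (snd p)) = (\<Sum>p\<leftarrow>ps. f u (fst p) (snd p)) + (\<Sum>p\<leftarrow>ps. f u' (fst p) (snd p))"
      "(\<Sum>p\<leftarrow>ps. f (sc c u) (fst p) (snd p)) = c * (\<Sum>p\<leftarrow>ps. f u (fst p) (snd p))"
      using f by (simp_all add: trilinear_def sum_list_addf sum_list_const_mult)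
    ultimately show "P t (f (u + u')) = P t (f u) + P t (f u')" "P t (f (sc c u)) = c * P t (f u)"
      by (simp_all add: tensor_sum_apply trilinear_bilinear[OF f]) (simp_all add: split_def)
  qed
  have \<beta>: "bilinear_form sc (pointwise (*)) \<beta>"
    using P(2) ev unfolding \<beta>_def bilinear_form_iff[OF vs vector_space_tensor]
    by (simp add: Vector_Spaces.linear_iff pointwise_def)
  have pure: "\<beta> u (tensor sc sc v w) = f u v w" for u v w
  proof -
    have "tensor sc sc v w \<in> ?T" unfolding tensor_space_def by (rule T.span_base) auto
    then show ?thesis using P(3) by (simp add: \<beta>_def tensor_def trilinear_bilinear[OF f])
  qed
  have com: "\<beta> u (comult H v) = sw (f u) v" for u v
  proof -
    have "comult H v \<in> ?T" using bialgebra_laws(2) unfolding coalgebra_def by blast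
    then show ?thesis using P(3) by (simp add: \<beta>_def sweedler_eval trilinear_bilinear[OF f])
  qed
  have eval: "sw F y \<beta> = sw (\<lambda>c d. F c d \<beta>) y" for F :: "'h \<Rightarrow> 'h \<Rightarrow> ('h, ('h,'h,'k) tensor, 'k) tensor" and y
    by (rule sweedler_apply)
  show ?thesis
    using fun_cong[OF coassoc_tensor[of x], of \<beta>]
    by (simp add: eval tensor_def[of sc "pointwise (*)"] \<beta> pure com)
qed

section \<open>The antipode as an anti-homomorphism\<close>

lemma form_eqI:
  assumes "\<And>\<phi>. Vector_Spaces.linear sc (*) \<phi> \<Longrightarrow> \<phi> x = \<phi> y"
  shows "x = y"
proof (rule ccontr)
  assume "x \<noteq> y"
  then have "x - y \<noteq> 0" by simp
  then obtain \<phi> where \<phi>: "Vector_Spaces.linear sc (*) \<phi>" "\<phi> (x - y) \<noteq> 0"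
    using exists_functional[OF vs] by blast
  then have "\<phi> x - \<phi> y \<noteq> 0"
    using module_hom.diff[OF \<phi>(1)[folded module_hom_iff_linear]] by simp
  then show False using assms[OF \<phi>(1)] by simp
qed

lemmas multilinear = antipode_linear counit_linear mult_scale distrib_left distrib_right
  sweedler_add sweedler_mult_left

lemma antipode_one: "S 1 = 1"
proof (rule form_eqI)
  fix \<phi> assume \<phi>: "Vector_Spaces.linear sc (*) \<phi>"
  have "bilinear_form sc sc (\<lambda>a b. \<phi> (S a * b))"
    using \<phi> by (simp add: form_iff multilinear)
  from sweedler_one[OF this] show "\<phi> (S 1) = \<phi> 1"
    by (simp add: form_antipode_left \<phi> bialgebra_laws)
qed

text \<open>
  The two sides are convolution inverses of the multiplication \<open>H \<otimes> H \<rightarrow> H\<close> on the left and on the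
  right. The sum \<open>S(x\<^sub>1 y\<^sub>1) x\<^sub>2 y\<^sub>2 S(y\<^sub>3) S(x\<^sub>3)\<close> is therefore computed twice: cancelling on the left
  leaves \<open>S y S x\<close>, cancelling on the right leaves \<open>S (x y)\<close>.
\<close>

lemma antipode_mult: "S (x * y) = S y * S x"
proof (rule form_eqI)
  fix \<phi> assume \<phi>: "Vector_Spaces.linear sc (*) \<phi>"
  have lin: "\<phi> (u + v) = \<phi> u + \<phi> v" "\<phi> (sc c u) = c * \<phi> u" for u v c
    using \<phi> by (simp_all add: form_iff)
  \<comment> \<open>\<open>S(w\<^sub>1 z\<^sub>1) w\<^sub>2 z\<^sub>2 = \<epsilon>(w) \<epsilon>(z) 1\<close>, with a right factor \<open>q\<close>\<close>
  have collapse: "sw (\<lambda>a b. sw (\<lambda>u v. \<phi> (S (a * u) * b * v * q)) z) w = \<epsilon> w * \<epsilon> z * \<phi> q" for w z q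
  proof -
    have "bilinear_form sc sc (\<lambda>a b. \<phi> (S a * b * q))" "Vector_Spaces.linear sc (*) (\<lambda>a. \<phi> (a * q))"
      by (simp_all add: form_iff multilinear lin)
    from sweedler_mult[OF this(1), of w z] form_antipode_left[OF this(2), of "w * z"]
    show ?thesis by (simp add: bialgebra_laws mult.assoc)
  qed
  have cancel: "sw (\<lambda>v w. \<phi> (p * v * S w * q)) z = \<epsilon> z * \<phi> (p * q)" for p q z
  proof -
    have "Vector_Spaces.linear sc (*) (\<lambda>a. \<phi> (p * a * q))" by (simp add: form_iff multilinear lin)
    from form_antipode_right[OF this, of z] show ?thesis by (simp add: mult.assoc)
  qed
  have tri: "trilinear (\<lambda>u v w. \<phi> (S (a * u) * b * v * S w * q))" for a b q
    by (simp add: trilinear_def multilinear lin)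
  have "\<phi> (S y * S x) = sw (\<lambda>x' c. \<epsilon> x' * sw (\<lambda>y' w. \<epsilon> y' * \<phi> (S w * S c)) y) x"
  proof -
    have "Vector_Spaces.linear sc (*) (\<lambda>w. \<phi> (S w * S c))" "Vector_Spaces.linear sc (*) (\<lambda>c. \<phi> (S y * S c))" for c
      by (simp_all add: form_iff multilinear lin)
    then show ?thesis by (simp add: form_counit_left)
  qed
  also have "\<dots> = sw (\<lambda>x' c. sw (\<lambda>y' w. sw (\<lambda>a b. sw (\<lambda>u v. \<phi> (S (a * u) * b * v * (S w * S c))) y') x') y) x"
    unfolding collapse by (simp add: sweedler_mult_left mult.assoc)
  also have "\<dots> = sw (\<lambda>x' c. sw (\<lambda>a b. sw (\<lambda>y' w. sw (\<lambda>u v. \<phi> (S (a * u) * b * v * S w * S c)) y') y) x') x"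
    by (subst (2) sweedler_swap) (simp add: mult.assoc)
  \<comment> \<open>regroup \<open>(y\<^sub>1 \<otimes> y\<^sub>2) \<otimes> y\<^sub>3\<close>, so that \<open>y\<^sub>2 S(y\<^sub>3)\<close> cancels\<close>
  also have "\<dots> = sw (\<lambda>x' c. sw (\<lambda>a b. sw (\<lambda>u y'. sw (\<lambda>v w. \<phi> (S (a * u) * b * v * S w * S c)) y') y) x') x"
    by (subst coassoc[OF tri]) simp
  also have "\<dots> = sw (\<lambda>x' c. sw (\<lambda>a b. \<phi> (S (a * y) * b * S c)) x') x"
  proof -
    have "Vector_Spaces.linear sc (*) (\<lambda>u. \<phi> (S (a * u) * b * S c))" for a b c
      by (simp add: form_iff multilinear lin)
    from form_counit_right[OF this] show ?thesis by (simp add: cancel mult.commute)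
  qed
  \<comment> \<open>the same regrouping for \<open>x\<close>\<close>
  also have "\<dots> = sw (\<lambda>a x'. sw (\<lambda>b c. \<phi> (S (a * y) * b * S c)) x') x"
    by (rule coassoc) (simp add: trilinear_def multilinear lin)
  also have "\<dots> = \<phi> (S (x * y))"
  proof -
    have lin': "Vector_Spaces.linear sc (*) (\<lambda>u. \<phi> (S (u * y)))"
      by (simp add: form_iff multilinear lin)
    have "sw (\<lambda>b c. \<phi> (S (a * y) * b * S c)) z = \<epsilon> z * \<phi> (S (a * y))" for a z
      using cancel[of "S (a * y)" 1 z] by simp
    then show ?thesis using form_counit_right[OF lin', of x] by (simp add: mult.commute)
  qed
  finally show "\<phi> (S (x * y)) = \<phi> (S y * S x)" ..
qed

text \<open>
  The dual of the preceding lemma, by the same argument: both sides are convolution inverses of the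
  comultiplication. With \<open>G y p q\<close> standing for \<open>S(y)\<^sub>1 p \<otimes> S(y)\<^sub>2 q\<close>, the element
  \<open>G x\<^sub>1 (x\<^sub>2 S(x\<^sub>5)) (x\<^sub>3 S(x\<^sub>4))\<close> is computed twice.
\<close>

lemma sweedler_antipode:
  assumes \<beta>: "bilinear_form sc sc \<beta>"
  shows "sw \<beta> (S x) = sw (\<lambda>a b. \<beta> (S b) (S a)) x"
proof -
  have lin: "\<beta> (u + v) w = \<beta> u w + \<beta> v w" "\<beta> u (v + w) = \<beta> u v + \<beta> u w"
    "\<beta> (sc c u) w = c * \<beta> u w" "\<beta> u (sc c w) = c * \<beta> u w" for u v w c
    using \<beta> by (simp_all add: form_iff)
  define G where "G y p q = sw (\<lambda>u v. \<beta> (u * p) (v * q)) (S y)" for y p q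
  have \<beta>': "bilinear_form sc sc (\<lambda>u v. \<beta> (u * p) (v * q))" for p q
    by (simp add: form_iff multilinear lin)
  have G: "trilinear G"
    unfolding trilinear_def G_def
    by (simp add: multilinear lin sweedler_linear[OF \<beta>'])
  have Glin: "G (u + v) p q = G u p q + G v p q" "G p (u + v) q = G p u q + G p v q" "G p q (u + v) = G p q u + G p q v"
    "G (sc c u) p q = c * G u p q" "G p (sc c u) q = c * G p u q" "G p q (sc c u) = c * G p q u" for u v p q c
    using G by (simp_all add: trilinear_def)
  \<comment> \<open>the comultiplication of \<open>S(w\<^sub>1) w\<^sub>2\<close>, multiplied by \<open>r \<otimes> s\<close> on the right\<close>
  have collapse: "sw (\<lambda>a z. sw (\<lambda>p q. G a (p * r) (q * s)) z) w = \<epsilon> w * \<beta> r s" for r s w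
  proof -
    let ?\<phi> = "\<lambda>t. sw (\<lambda>u v. \<beta> (u * r) (v * s)) t"
    have "Vector_Spaces.linear sc (*) ?\<phi>" by (simp add: form_iff sweedler_linear[OF \<beta>'])
    from form_antipode_left[OF this, of w]
    have "sw (\<lambda>a z. ?\<phi> (S a * z)) w = \<epsilon> w * \<beta> r s" by (simp add: sweedler_one[OF \<beta>'])
    moreover have "?\<phi> (S a * z) = sw (\<lambda>p q. G a (p * r) (q * s)) z" for a z
      unfolding G_def sweedler_mult[OF \<beta>'] by (subst sweedler_swap) (simp add: mult.assoc)
    ultimately show ?thesis by simp
  qed
  have bil: "bilinear_form sc sc (\<lambda>c1 c2. G a (p * S c2) (q * S c1))" for a p q
    by (simp add: form_iff multilinear Glin)
  have bil': "bilinear_form sc sc (\<lambda>p q. G a (p * S c2) (q * S c1))" for a c1 c2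
    by (simp add: form_iff multilinear Glin)
  have bilS: "bilinear_form sc sc (\<lambda>c1 c2. \<beta> (S c2) (S c1))"
    by (simp add: form_iff multilinear lin)
  \<comment> \<open>\<open>w\<^sub>1 S(w\<^sub>4) \<otimes> w\<^sub>2 S(w\<^sub>3) = \<epsilon>(w) 1 \<otimes> 1\<close>, cancelling from the inside\<close>
  have inner: "sw (\<lambda>z c. sw (\<lambda>c1 c2. sw (\<lambda>p q. G a (p * S c2) (q * S c1)) z) c) w = \<epsilon> w * G a 1 1" for a w
  proof -
    have cancel: "sw (\<lambda>q c. sw (\<lambda>c1 c2. G a (p * S c2) (q * S c1)) c) t = G a (p * S t) 1" for p t
    proof -
      have "sw (\<lambda>q c. sw (\<lambda>c1 c2. G a (p * S c2) (q * S c1)) c) t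
          = sw (\<lambda>y c2. sw (\<lambda>q c1. G a (p * S c2) (q * S c1)) y) t"
        by (rule coassoc[symmetric]) (simp add: trilinear_def multilinear Glin)
      also have "\<dots> = sw (\<lambda>y c2. \<epsilon> y * G a (p * S c2) 1) t"
        by (subst form_antipode_right) (simp_all add: form_iff Glin)
      also have "\<dots> = G a (p * S t) 1"
        by (rule form_counit_left) (simp add: form_iff multilinear Glin)
      finally show ?thesis .
    qed
    have "sw (\<lambda>z c. sw (\<lambda>c1 c2. sw (\<lambda>p q. G a (p * S c2) (q * S c1)) z) c) w
        = sw (\<lambda>z c. sw (\<lambda>p q. sw (\<lambda>c1 c2. G a (p * S c2) (q * S c1)) c) z) w"
      by (subst (2) sweedler_swap) simp
    also have "\<dots> = sw (\<lambda>p t. sw (\<lambda>q c. sw (\<lambda>c1 c2. G a (p * S c2) (q * S c1)) c) t) w"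
      by (rule coassoc) (simp add: trilinear_def multilinear Glin sweedler_linear[OF bil])
    also have "\<dots> = sw (\<lambda>p t. G a (p * S t) 1) w" by (simp only: cancel)
    also have "\<dots> = \<epsilon> w * G a 1 1"
      by (subst form_antipode_right) (simp_all add: form_iff Glin)
    finally show ?thesis .
  qed
  have "sw (\<lambda>a b. \<beta> (S b) (S a)) x = sw (\<lambda>x' c. \<epsilon> x' * sw (\<lambda>c1 c2. \<beta> (S c2) (S c1)) c) x"
    by (rule form_counit_left[symmetric]) (simp add: form_iff sweedler_linear[OF bilS])
  also have "\<dots> = sw (\<lambda>x' c. sw (\<lambda>c1 c2. sw (\<lambda>a z. sw (\<lambda>p q. G a (p * S c2) (q * S c1)) z) x') c) x"
    by (simp add: collapse sweedler_mult_left)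
  also have "\<dots> = sw (\<lambda>x' c. sw (\<lambda>a z. sw (\<lambda>c1 c2. sw (\<lambda>p q. G a (p * S c2) (q * S c1)) z) c) x') x"
    by (subst (2) sweedler_swap) simp
  also have "\<dots> = sw (\<lambda>a w. sw (\<lambda>z c. sw (\<lambda>c1 c2. sw (\<lambda>p q. G a (p * S c2) (q * S c1)) z) c) w) x"
  proof (rule coassoc)
    have "bilinear_form sc sc (\<lambda>c1 c2. sw (\<lambda>p q. G a (p * S c2) (q * S c1)) z)" for a z
      by (simp add: form_iff multilinear Glin)
    then show "trilinear (\<lambda>a z c. sw (\<lambda>c1 c2. sw (\<lambda>p q. G a (p * S c2) (q * S c1)) z) c)"
      by (simp add: trilinear_def multilinear Glin sweedler_linear[OF bil'] sweedler_linear)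
  qed
  also have "\<dots> = sw (\<lambda>a w. G a 1 1 * \<epsilon> w) x" by (simp add: inner mult.commute)
  also have "\<dots> = G x 1 1" by (rule form_counit_right) (simp add: form_iff Glin)
  finally show ?thesis by (simp add: G_def)
qed


section \<open>Haar functionals are faithful\<close>

text \<open>
  The invariance \<open>h(x\<^sub>1) x\<^sub>2 = h(x) 1\<close> says that \<open>h\<close> is a comodule map from the right regular comodule
  to the trivial one; with \<open>h 1 = 1\<close> it splits the inclusion of the scalars.
\<close>

definition haar where
  "haar h \<longleftrightarrow> Vector_Spaces.linear sc (*) h \<and> h 1 = 1 \<and> (\<forall>x. sw (\<lambda>u v. sc (h u) v) x = sc (h x) 1)"

lemma haar_form:
  assumes "haar h" "Vector_Spaces.linear sc (*) \<phi>"
  shows "sw (\<lambda>u v. h u * \<phi> v) x = h x * \<phi> 1"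
  using linear_sweedler[OF assms(2), of H "\<lambda>u v. sc (h u) v" x] assms
  by (simp add: haar_def form_iff)

text \<open>
  If every contraction of the first leg of \<open>x\<^sub>1 \<otimes> x\<^sub>2\<close> lies in \<open>M\<close>, then \<open>x\<^sub>1 \<otimes> x\<^sub>2\<close> is a combination of
  tensors with second leg in \<open>M\<close>: expand the first legs in a basis and collect the coefficients.
\<close>

lemma sweedler_vanish:
  assumes F: "bilinear_form sc sc F"
    and M: "\<And>\<phi>. Vector_Spaces.linear sc (*) \<phi> \<Longrightarrow> sw (\<lambda>u v. sc (\<phi> u) v) x \<in> M"
    and zero: "\<And>u v. v \<in> M \<Longrightarrow> F u v = 0"
  shows "sw F x = 0"
proof -
  define R where "R = representation (extend_basis {})"
  note B = independent_extend_basis[OF independent_empty] span_extend_basis[OF independent_empty]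
  obtain ps where ps: "sw f x = (\<Sum>(u, v)\<leftarrow>ps. f u v)" for f :: "'h \<Rightarrow> 'h \<Rightarrow> 'k"
    by (simp add: sweedler_def)
  have lin: "Vector_Spaces.linear sc (*) (\<lambda>u. R u b)" for b
    using B by (simp add: form_iff R_def representation_add representation_scale)
  define T where "T = (\<Union>(u, v)\<in>set ps. {b. R u b \<noteq> 0})"
  have "finite T" by (auto simp: T_def R_def finite_representation)
  have expand: "F u v = (\<Sum>b\<in>T. R u b * F b v)" if "(u, v) \<in> set ps" for u v
  proof -
    have "(\<Sum>b\<in>T. sc (R u b) b) = (\<Sum>b | R u b \<noteq> 0. sc (R u b) b)"
      using that by (intro sum.mono_neutral_right \<open>finite T\<close>) (auto simp: T_def)
    also have "\<dots> = u" using B by (simp add: R_def sum_nonzero_representation_eq)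
    finally have "F u v = F (\<Sum>b\<in>T. sc (R u b) b) v" by simp
    also have "\<dots> = (\<Sum>b\<in>T. R u b * F b v)"
    proof -
      have "Vector_Spaces.linear sc (*) (\<lambda>u. F u v)" using F by (simp add: bilinear_form_def)
      then interpret F: Vector_Spaces.linear sc "(*)" "\<lambda>u. F u v" .
      show ?thesis by (simp add: F.sum F.scale)
    qed
    finally show ?thesis .
  qed
  have "sw F x = (\<Sum>(u, v)\<leftarrow>ps. \<Sum>b\<in>T. R u b * F b v)"
    unfolding ps by (intro arg_cong[where f = sum_list] map_cong) (auto simp: expand)
  also have "\<dots> = (\<Sum>b\<in>T. \<Sum>(u, v)\<leftarrow>ps. R u b * F b v)"
    by (induction ps) (simp_all add: sum.distrib split_def)
  also have "\<dots> = (\<Sum>b\<in>T. F b (sw (\<lambda>u v. sc (R u b) v) x))"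
  proof (rule sum.cong[OF refl])
    fix b
    have "Vector_Spaces.linear sc (*) (F b)" using F by (simp add: bilinear_form_def)
    from linear_sweedler[OF this, of H "\<lambda>u v. sc (R u b) v" x]
    have "sw (\<lambda>u v. R u b * F b v) x = F b (sw (\<lambda>u v. sc (R u b) v) x)"
      using F by (simp add: form_iff)
    then show "(\<Sum>(u, v)\<leftarrow>ps. R u b * F b v) = F b (sw (\<lambda>u v. sc (R u b) v) x)"
      unfolding ps .
  qed
  also have "\<dots> = 0" using zero M[OF lin] by simp
  finally show ?thesis .
qed

text \<open>
  Let \<open>M\<close> be the set of all \<open>v\<close> with \<open>h(S v * y) = 0\<close> for every \<open>y\<close>. Invariance of \<open>h\<close> gives
  \<open>x\<^sub>1 h(S(x\<^sub>2) y) = h(S(x) y\<^sub>1) y\<^sub>2\<close>, so \<open>M\<close> is a left coideal. Applying \<open>h \<circ> S\<close> to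
  \<open>S(v\<^sub>1) v\<^sub>2 = \<epsilon>(v) 1\<close> for \<open>v\<close> in \<open>M\<close> yields \<open>\<epsilon>(v) = h(S(v\<^sub>2) S(S(v\<^sub>1))) = 0\<close>, since \<open>v\<^sub>2\<close> may be taken
  in \<open>M\<close>. A left coideal on which the counit vanishes is zero, because \<open>x = x\<^sub>1 \<epsilon>(x\<^sub>2)\<close>.
\<close>

lemma haar_faithful:
  assumes h: "haar h" and x: "\<And>y. h (S x * y) = 0"
  shows "x = 0"
proof -
  have hlin: "h (u + v) = h u + h v" "h (sc c u) = c * h u" for u v c
    using h by (simp_all add: haar_def form_iff)
  define M where "M = {v. \<forall>y. h (S v * y) = 0}"
  \<comment> \<open>\<open>x\<^sub>1 h(S(x\<^sub>2) y) = h(S(x) y\<^sub>1) y\<^sub>2\<close>, under a linear form\<close>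
  have transfer: "sw (\<lambda>u v. \<phi> u * h (S v * y)) x = sw (\<lambda>u v. h (S x * u) * \<phi> v) y"
    if \<phi>: "Vector_Spaces.linear sc (*) \<phi>" for \<phi> x y
  proof -
    have lin: "\<phi> (u + v) = \<phi> u + \<phi> v" "\<phi> (sc c u) = c * \<phi> u" for u v c
      using \<phi> by (simp_all add: form_iff)
    have bil: "bilinear_form sc sc (\<lambda>s t. h s * \<phi> (u * t))" for u
      by (simp add: form_iff multilinear lin hlin algebra_simps)
    have bil2: "bilinear_form sc sc (\<lambda>p q. sw (\<lambda>c d. h (p * c) * \<phi> (u * (q * d))) y)" for u
      by (simp add: form_iff multilinear lin hlin algebra_simps)
    \<comment> \<open>invariance of \<open>h\<close> at \<open>S v * y\<close>, whose legs are \<open>S(v\<^sub>2) y\<^sub>1\<close> and \<open>S(v\<^sub>1) y\<^sub>2\<close>\<close>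
    have expand: "\<phi> u * h (S v * y) =
        sw (\<lambda>a b. sw (\<lambda>c d. h (S b * c) * \<phi> (u * S a * d)) y) v" for u v
    proof -
      have "Vector_Spaces.linear sc (*) (\<lambda>t. \<phi> (u * t))" by (simp add: form_iff multilinear lin)
      from haar_form[OF h this] have "\<phi> u * h (S v * y) = sw (\<lambda>s t. h s * \<phi> (u * t)) (S v * y)"
        by (simp add: mult.commute)
      also have "\<dots> = sw (\<lambda>a b. sw (\<lambda>c d. h (S b * c) * \<phi> (u * S a * d)) y) v"
        unfolding sweedler_mult[OF bil] sweedler_antipode[OF bil2] by (simp add: mult.assoc)
      finally show ?thesis .
    qed
    have "sw (\<lambda>u v. \<phi> u * h (S v * y)) x
        = sw (\<lambda>u v. sw (\<lambda>a b. sw (\<lambda>c d. h (S b * c) * \<phi> (u * S a * d)) y) v) x"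
      by (simp only: expand)
    also have "\<dots> = sw (\<lambda>w b. sw (\<lambda>u a. sw (\<lambda>c d. h (S b * c) * \<phi> (u * S a * d)) y) w) x"
      by (rule coassoc[symmetric]) (simp add: trilinear_def multilinear lin hlin algebra_simps)
    also have "\<dots> = sw (\<lambda>w b. \<epsilon> w * sw (\<lambda>c d. h (S b * c) * \<phi> d) y) x"
    proof -
      have "sw (\<lambda>u a. sw (\<lambda>c d. h (S b * c) * \<phi> (u * S a * d)) y) w
          = \<epsilon> w * sw (\<lambda>c d. h (S b * c) * \<phi> (1 * d)) y" for b w
        by (rule form_antipode_right) (simp add: form_iff multilinear lin hlin algebra_simps)
      then show ?thesis by simp
    qed
    also have "\<dots> = sw (\<lambda>c d. h (S x * c) * \<phi> d) y"
      by (rule form_counit_left) (simp add: form_iff multilinear lin hlin algebra_simps)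
    finally show ?thesis .
  qed
  \<comment> \<open>the contractions \<open>\<phi>(x\<^sub>1) x\<^sub>2\<close> stay in \<open>M\<close>\<close>
  have coideal: "sw (\<lambda>u v. sc (\<phi> u) v) x \<in> M" if \<phi>: "Vector_Spaces.linear sc (*) \<phi>" and x: "x \<in> M" for \<phi> x
  proof -
    have "h (S (sw (\<lambda>u v. sc (\<phi> u) v) x) * y) = 0" for y
    proof -
      have "Vector_Spaces.linear sc (*) (\<lambda>t. h (S t * y))" by (simp add: form_iff multilinear hlin)
      from linear_sweedler[OF this, of H "\<lambda>u v. sc (\<phi> u) v" x] transfer[OF \<phi>] x show ?thesis
        by (simp add: multilinear hlin M_def)
    qed
    then show ?thesis by (simp add: M_def)
  qed
  have counit_zero: "\<epsilon> v = 0" if "v \<in> M" for v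
  proof -
    have "sw (\<lambda>a b. h (S b * S (S a))) v = 0"
      by (rule sweedler_vanish[OF _ coideal[OF _ that]]) (simp_all add: form_iff multilinear hlin M_def)
    moreover have "sw (\<lambda>a b. h (S (S a * b))) v = \<epsilon> v * h (S 1)"
      by (rule form_antipode_left) (simp add: form_iff multilinear hlin)
    ultimately show ?thesis using h by (simp add: antipode_mult antipode_one haar_def)
  qed
  have "x \<in> M" using x by (simp add: M_def)
  show "x = 0"
  proof (rule form_eqI)
    fix \<phi> assume \<phi>: "Vector_Spaces.linear sc (*) \<phi>"
    have "\<phi> x = sw (\<lambda>u v. \<phi> u * \<epsilon> v) x" by (rule form_counit_right[OF \<phi>, symmetric])
    also have "\<dots> = \<epsilon> (sw (\<lambda>u v. sc (\<phi> u) v) x)"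
      by (simp add: linear_sweedler[OF linear_counit] counit_linear)
    also have "\<dots> = 0" by (rule counit_zero[OF coideal[OF \<phi> \<open>x \<in> M\<close>]])
    also have "\<dots> = \<phi> 0" using \<phi> form_iff(1)[of \<phi>] by (metis scale_zero_left mult_zero_left)
    finally show "\<phi> x = \<phi> 0" .
  qed
qed

lemma inj_antipode:
  assumes "haar h"
  shows "inj S"
proof (rule injI)
  fix x y assume "S x = S y"
  then have "S (x - y) = 0"
    using module_hom.diff[OF linear_antipode[folded module_hom_iff_linear]] by simp
  moreover have "h 0 = 0" using assms form_iff(1)[of h] unfolding haar_def by (metis scale_zero_left mult_zero_left)
  ultimately have "x - y = 0" using haar_faithful[OF assms, of "x - y"] by simp
  then show "x = y" by simp
qed

end

section \<open>Haar functionals from cosemisimplicity\<close>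

text \<open>
  A nonzero vector has a nonzero component in some summand. The components themselves are not
  constructed: if none of the complements omitted \<open>x\<close>, the summands could be removed one by one from a
  finite subfamily whose span contains \<open>x\<close>.
\<close>

lemma internal_direct_sum_separates:
  assumes vs: "vector_space s" and sum: "internal_direct_sum s F V" and x: "x \<in> V" "x \<noteq> 0"
  shows "\<exists>W\<in>F. x \<notin> module.span s (\<Union>(F - {W}))"
proof -
  interpret P: vector_space s by (rule vs)
  have sub: "\<And>W. W \<in> F \<Longrightarrow> P.subspace W" and span: "P.span (\<Union>F) = V"
    and disj: "\<And>W. W \<in> F \<Longrightarrow> W \<inter> P.span (\<Union>(F - {W})) = {0}"
    using sum unfolding internal_direct_sum_def by auto
  show ?thesis
  proof (rule ccontr)
    assume neg: "\<not> ?thesis"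
    have finite_part: "\<exists>F0\<subseteq>F. finite F0 \<and> x \<in> P.span (\<Union>F0)" if "x \<in> P.span (\<Union>F)" for x
      using that
    proof (induction rule: P.span_induct_alt)
      case base
      then show ?case by (intro exI[of _ "{}"]) (simp add: zero_fun_def)
    next
      case (step c x y)
      then obtain W F0 where W: "W \<in> F" "x \<in> W" and F0: "F0 \<subseteq> F" "finite F0" "y \<in> P.span (\<Union>F0)" by blast
      have "x \<in> P.span (\<Union>(insert W F0))" by (rule P.span_base) (use W in auto)
      moreover have "y \<in> P.span (\<Union>(insert W F0))" using F0(3) by (rule subsetD[OF P.span_mono, rotated]) auto
      ultimately have mem: "s c x + y \<in> P.span (\<Union>(insert W F0))" by (intro P.span_add P.span_scale)
      show ?case by (rule exI[of _ "insert W F0"], intro conjI mem) (use W F0 in auto)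
    qed
    have vanish: "x = 0" if "finite F0" "F0 \<subseteq> F" "x \<in> P.span (\<Union>F0)" "\<And>W. W \<in> F \<Longrightarrow> x \<in> P.span (\<Union>(F - {W}))" for F0 x
      using that(1-3)
    proof (induction F0)
      case empty
      then show ?case by simp
    next
      case (insert W F0)
      then have "x \<in> P.span (W \<union> \<Union>F0)" by simp
      then obtain w r where wr: "x = w + r" "w \<in> P.span W" "r \<in> P.span (\<Union>F0)"
        unfolding P.span_Un by blast
      have "w \<in> W" using wr(2) sub insert.prems by (simp add: P.span_eq_iff[THEN iffD2])
      have "r \<in> P.span (\<Union>(F - {W}))"
        using wr(3) by (rule subsetD[OF P.span_mono, rotated]) (use insert in auto)
      then have "x - r \<in> P.span (\<Union>(F - {W}))"
        using that(4)[of W] insert.prems by (intro P.span_diff) auto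
      then have "w = 0" using wr(1) \<open>w \<in> W\<close> disj insert.prems by auto
      then show ?case using insert wr by simp
    qed
    obtain F0 where "F0 \<subseteq> F" "finite F0" "x \<in> P.span (\<Union>F0)"
      using finite_part[of x] span x(1) by auto
    then have "x = 0" using neg vanish by blast
    then show False using x(2) by simp
  qed
qed

text \<open>
  The comodules that cosemisimplicity speaks of live in spaces of sequences; the regular comodule is
  embedded there by constant sequences.
\<close>

definition const_seq :: "'a \<Rightarrow> nat \<Rightarrow> 'a" where "const_seq a = (\<lambda>_. a)"

lemma const_seq_simps:
  "const_seq (a + b) = const_seq a + const_seq b"
  "const_seq a n = a" "const_seq (a - b :: 'a::ab_group_add) = const_seq a - const_seq b"
  "const_seq (0 :: 'a) = 0"
  "const_seq x = const_seq y \<longleftrightarrow> x = y"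
  by (auto simp: const_seq_def pointwise_def fun_eq_iff)

lemma const_seq_scale: "const_seq (s c a) = pointwise s c (const_seq a)"
  by (simp add: const_seq_def pointwise_def)

context hopf begin

text \<open>
  As a rewrite rule, the general fact would match an arbitrary function of two arguments.
\<close>

lemmas const_seq_scale' = const_seq_scale[of sc]

abbreviation "pw \<equiv> pointwise sc :: 'k \<Rightarrow> (nat \<Rightarrow> 'h) \<Rightarrow> nat \<Rightarrow> 'h"

lemma vs_pw: "vector_space pw" using vs by (rule vector_space_pointwise)

text \<open>
  Reading the value at \<open>0\<close> gives the comultiplication on constant sequences and keeps the map linear on
  all sequences.
\<close>

definition const_coaction :: "(nat \<Rightarrow> 'h) \<Rightarrow> (nat \<Rightarrow> 'h, 'h, 'k) tensor"
  where "const_coaction v = sw (\<lambda>u w. tensor pw sc (const_seq u) w) (v 0)"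

lemma bilinear_const_seq:
  assumes "bilinear_form pw s2 \<beta>" "vector_space s2"
  shows "bilinear_form sc s2 (\<lambda>u w. \<beta> (const_seq u) w)"
  using assms by (simp add: bilinear_form_iff[OF vs assms(2)] bilinear_form_iff[OF vs_pw assms(2)] const_seq_simps const_seq_scale')

lemma const_coaction_eval:
  "const_coaction v \<beta> = (if bilinear_form pw sc \<beta> then sw (\<lambda>u w. \<beta> (const_seq u) w) (v 0) else 0)"
  unfolding const_coaction_def sweedler_apply by (simp add: tensor_def)

lemma const_coaction_linear:
  "const_coaction (v + w) = const_coaction v + const_coaction w"
  "const_coaction (pw c v) = pointwise (*) c (const_coaction v)"
  by (auto simp: fun_eq_iff const_coaction_eval pointwise_apply sweedler_linear[OF bilinear_const_seq] vs)

lemma const_coaction_tensor_sum: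
  assumes "comult H a = tensor_sum sc sc qs"
  shows "const_coaction (const_seq a) = tensor_sum pw sc (map (\<lambda>(u, w). (const_seq u, w)) qs)"
  unfolding fun_eq_iff tensor_sum_apply const_coaction_eval
  by (auto simp: const_seq_simps split_def sweedler_list[OF bilinear_const_seq assms] vs comp_def)

text \<open>
  Every right coideal \<open>U\<close> is a comodule under the comultiplication. It is needed for \<open>H\<close> itself and for
  the line spanned by the unit.
\<close>

lemma const_comodule:
  assumes U: "subspace U" and comult_U: "\<And>a. a \<in> U \<Longrightarrow> comult H a \<in> tensor_space sc sc U UNIV"
  shows "comodule pw H (const_seq ` U) const_coaction"
proof -
  interpret P: vector_space pw by (rule vs_pw)
  let ?V = "const_seq ` U" and ?\<rho> = const_coaction
  let ?t = "tensor pw (pointwise (*)) :: _ \<Rightarrow> ('h, 'h, 'k) tensor \<Rightarrow> _"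
  have V: "P.subspace ?V"
    using U unfolding subspace_def P.subspace_def
    by (auto simp flip: const_seq_simps(1,4) const_seq_scale')
  \<comment> \<open>A map on \<open>V \<otimes> H\<close> that agrees with a bilinear \<open>g\<close> on pure tensors can be computed from the comultiplication.\<close>
  have lift: "tensor_lift pw sc ?V UNIV F (?\<rho> (const_seq a)) = sw g a"
    if a: "a \<in> U" and s3: "vector_space s3"
      and Fg: "\<And>u w. u \<in> U \<Longrightarrow> F (const_seq u) w = g u w"
      and g: "\<And>v v' w. g (v + v') w = g v w + g v' w" "\<And>v w w'. g v (w + w') = g v w + g v w'"
        "\<And>c v w. g (sc c v) w = s3 c (g v w)" "\<And>c v w. g v (sc c w) = s3 c (g v w)"
    for a F g and s3 :: "'k \<Rightarrow> 'x::ab_group_add \<Rightarrow> 'x"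
  proof -
    obtain qs where qs: "set qs \<subseteq> U \<times> UNIV" "comult H a = tensor_sum sc sc qs"
      using tensor_space_imp_list[OF vs vs U comult_U[OF a]] by metis
    have "tensor_lift pw sc ?V UNIV F (?\<rho> (const_seq a))
        = (\<Sum>(u, w)\<leftarrow>map (\<lambda>(u, w). (const_seq u, w)) qs. F u w)"
      unfolding const_coaction_tensor_sum[OF qs(2)]
      using qs(1) subspace_add[OF U] subspace_scale[OF U]
      by (intro tensor_lift_eq[OF vs_pw vs s3 V subspace_UNIV])
        (auto simp: Fg g simp flip: const_seq_simps(1) const_seq_scale')
    also have "\<dots> = (\<Sum>(u, w)\<leftarrow>qs. g u w)"
    proof -
      have "F (const_seq u) w = g u w" if "(u, w) \<in> set qs" for u w using that qs(1) Fg by blast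
      then show ?thesis by (auto intro!: arg_cong[where f = sum_list])
    qed
    also have "\<dots> = tensor_lift sc sc UNIV UNIV g (comult H a)"
      unfolding qs(2) by (intro tensor_lift_eq[OF vs vs s3 subspace_UNIV subspace_UNIV, symmetric]) (simp_all add: g)
    also have "\<dots> = sw g a" by (rule tensor_lift_comult[OF s3 g])
    finally show ?thesis .
  qed
  note t = const_seq_simps const_seq_scale' vs vs_pw vector_space_tensor tensor_add_left tensor_add_right tensor_scale_left tensor_scale_right
  have assoc: "tensor_assoc pw sc sc ?V UNIV (?\<rho> (const_seq a)) h
      = sw (\<lambda>u v. ?t (const_seq u) (tensor sc sc v h)) a" if "a \<in> U" for a h
    unfolding tensor_assoc_def
    by (rule lift[OF that vector_space_tensor]) (simp_all add: t)
  have bil: "bilinear_form sc sc (\<lambda>u v. ?t (const_seq u) (tensor sc sc v h) \<beta>)" for h \<beta>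
    by (simp add: form_iff t pointwise_apply)
  have coassoc_V: "tensor_lift pw sc ?V UNIV (\<lambda>v h. tensor_assoc pw sc sc ?V UNIV (?\<rho> v) h) (?\<rho> (const_seq a))
      = tensor_lift pw sc ?V UNIV (\<lambda>v h. ?t v (comult H h)) (?\<rho> (const_seq a))" if a: "a \<in> U" for a
  proof -
    have "tensor_lift pw sc ?V UNIV (\<lambda>v h. tensor_assoc pw sc sc ?V UNIV (?\<rho> v) h) (?\<rho> (const_seq a))
       = sw (\<lambda>a h. sw (\<lambda>u v. ?t (const_seq u) (tensor sc sc v h)) a) a"
      by (rule lift[OF a vector_space_tensor])
       (simp_all add: assoc fun_eq_iff sweedler_apply pointwise_apply sweedler_linear[OF bil] t
          sweedler_add sweedler_mult_left)
    also have "\<dots> = sw (\<lambda>u h. ?t (const_seq u) (comult H h)) a"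
    proof
      fix \<beta>
      show "sw (\<lambda>a h. sw (\<lambda>u v. ?t (const_seq u) (tensor sc sc v h)) a) a \<beta> = sw (\<lambda>u h. ?t (const_seq u) (comult H h)) a \<beta>"
      proof (cases "bilinear_form pw (pointwise (*)) \<beta>")
        case True
        then show ?thesis
          using fun_cong[OF coassoc_tensor[of a], of "\<lambda>u w. \<beta> (const_seq u) w"]
            bilinear_const_seq[OF True vector_space_tensor]
          by (simp add: sweedler_apply tensor_def[of sc "pointwise (*)"] tensor_def[of pw])
      qed (simp add: sweedler_apply tensor_def[of pw])
    qed
    also have "\<dots> = tensor_lift pw sc ?V UNIV (\<lambda>v h. ?t v (comult H h)) (?\<rho> (const_seq a))"
      using linear_comult
      by (intro lift[OF a vector_space_tensor, symmetric]) (simp_all add: t Vector_Spaces.linear_iff)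
    finally show ?thesis .
  qed
  have counit_V: "tensor_lift pw sc ?V UNIV (\<lambda>v h. pw (\<epsilon> h) v) (?\<rho> (const_seq a)) = const_seq a" if a: "a \<in> U" for a
  proof -
    have lin: "Vector_Spaces.linear sc pw const_seq" by (simp add: Vector_Spaces.linear_iff t)
    have "tensor_lift pw sc ?V UNIV (\<lambda>v h. pw (\<epsilon> h) v) (?\<rho> (const_seq a)) = sw (\<lambda>u h. pw (\<epsilon> h) (const_seq u)) a"
      by (rule lift[OF a vs_pw]) (simp_all add: t counit_linear P.scale_right_distrib P.scale_left_distrib mult.commute)
    also have "\<dots> = const_seq (sw (\<lambda>u h. sc (\<epsilon> h) u) a)"
      unfolding linear_sweedler[OF lin] by (simp add: t)
    finally show ?thesis by (simp add: counit_right)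
  qed
  have range: "?\<rho> (const_seq a) \<in> tensor_space pw sc ?V UNIV" if a: "a \<in> U" for a
  proof -
    obtain qs where qs: "set qs \<subseteq> U \<times> UNIV" "comult H a = tensor_sum sc sc qs"
      using tensor_space_imp_list[OF vs vs U comult_U[OF a]] by metis
    show ?thesis unfolding const_coaction_tensor_sum[OF qs(2)]
      using qs(1) by (intro tensor_sum_in_tensor_space) auto
  qed
  show ?thesis
    unfolding comodule_def
    using V vs_pw const_coaction_linear coassoc_V counit_V range by auto
qed


text \<open>
  Decompose the regular comodule into simple ones and choose a summand \<open>W\<close> in which the unit has a
  nonzero component; let \<open>p\<close> be the projection onto \<open>W\<close>. It is colinear, so \<open>p 1\<close> is a coinvariant of the
  regular comodule, which makes it a scalar. Hence \<open>W\<close> contains the unit, and being simple it is the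
  line spanned by the unit. So \<open>p a = h(a) 1\<close> for a linear form \<open>h\<close>, and colinearity of \<open>p\<close> is
  invariance of \<open>h\<close>.
\<close>

lemma cosemisimple_haar:
  assumes "cosemisimple H"
  shows "\<exists>h. haar h"
proof -
  interpret P: vector_space pw by (rule vs_pw)
  interpret T: vector_space "pointwise (*) :: 'k \<Rightarrow> (((nat \<Rightarrow> 'h) \<Rightarrow> 'h \<Rightarrow> 'k) \<Rightarrow> 'k) \<Rightarrow> _"
    by (rule vector_space_tensor)
  note cs = const_seq_simps const_seq_scale'
  have "comodule pw H (range const_seq) const_coaction"
    by (rule const_comodule[OF subspace_UNIV]) (use bialgebra_laws(2) in \<open>auto simp: coalgebra_def\<close>)
  with assms have "\<exists>F. (\<forall>W\<in>F. simple_comodule pw H W const_coaction) \<and> internal_direct_sum pw F (range const_seq)"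
    unfolding cosemisimple_def by (elim allE impE) assumption
  then obtain F where simple: "\<And>W. W \<in> F \<Longrightarrow> simple_comodule pw H W const_coaction"
    and sum: "internal_direct_sum pw F (range const_seq)"
    by blast
  define rest where "rest W = P.span (\<Union>(F - {W}))" for W
  have sub: "\<And>W. W \<in> F \<Longrightarrow> P.subspace W" and span: "P.span (\<Union>F) = range const_seq"
    and disj: "\<And>W. W \<in> F \<Longrightarrow> W \<inter> rest W = {0}"
    using sum unfolding internal_direct_sum_def rest_def by auto
  have "const_seq (1 :: 'h) \<noteq> 0" by (simp add: const_seq_def fun_eq_iff)
  then have "\<exists>W\<in>F. const_seq 1 \<notin> rest W"
    using internal_direct_sum_separates[OF vs_pw sum, of "const_seq 1"] by (simp add: rest_def)
  then obtain W where W: "W \<in> F" and one: "const_seq 1 \<notin> rest W" by blast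
  have rest_sub: "P.subspace (rest W)" unfolding rest_def by (rule P.subspace_span)
  have decomp: "\<exists>b. const_seq b \<in> W \<and> const_seq (a - b) \<in> rest W" for a
  proof -
    have "const_seq a \<in> P.span (\<Union>F)" using span by auto
    also have "\<Union>F = W \<union> \<Union>(F - {W})" using W by auto
    finally obtain w r where wr: "const_seq a = w + r" "w \<in> P.span W" "r \<in> rest W"
      unfolding P.span_Un rest_def by blast
    have "w \<in> W" using wr(2) sub[OF W] by (simp add: P.span_eq_iff[THEN iffD2])
    then have "w \<in> range const_seq" using span W P.span_base by blast
    then obtain b where b: "w = const_seq b" by blast
    then have "const_seq (a - b) = r" using wr(1) by (simp add: cs)
    then show ?thesis using wr b \<open>w \<in> W\<close> by blast
  qed
  define p where "p a = (SOME b. const_seq b \<in> W \<and> const_seq (a - b) \<in> rest W)" for a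
  have p: "const_seq (p a) \<in> W" "const_seq (a - p a) \<in> rest W" for a
    using someI_ex[OF decomp[of a]] unfolding p_def by blast+
  have p_unique: "p a = b" if "const_seq b \<in> W" "const_seq (a - b) \<in> rest W" for a b
  proof -
    have "const_seq (p a - b) \<in> W" using P.subspace_diff[OF sub[OF W] p(1) that(1)] by (simp add: cs)
    moreover have "const_seq (p a - b) \<in> rest W"
      using P.subspace_diff[OF rest_sub that(2) p(2)[of a]] by (simp flip: const_seq_simps(3))
    ultimately have "const_seq (p a - b) = const_seq 0"
      using disj[OF W] unfolding const_seq_simps(4) by blast
    then show ?thesis by (simp only: const_seq_simps(5) right_minus_eq)
  qed
  have p_add: "p (a + b) = p a + p b" for a b
  proof (rule p_unique)
    show "const_seq (p a + p b) \<in> W" using P.subspace_add[OF sub[OF W] p(1) p(1)] by (simp add: cs)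
    show "const_seq (a + b - (p a + p b)) \<in> rest W"
      using P.subspace_add[OF rest_sub p(2)[of a] p(2)[of b]]
      by (simp add: algebra_simps flip: const_seq_simps(1))
  qed
  have p_scale: "p (sc c a) = sc c (p a)" for a c
  proof (rule p_unique)
    show "const_seq (sc c (p a)) \<in> W" using P.subspace_scale[OF sub[OF W] p(1)] by (simp add: cs)
    show "const_seq (sc c a - sc c (p a)) \<in> rest W"
      using P.subspace_scale[OF rest_sub p(2)[of a]]
      by (simp add: scale_right_diff_distrib flip: const_seq_scale')
  qed
  have p_W: "p a = a" if "const_seq a \<in> W" for a
    using that P.subspace_0[OF rest_sub] by (intro p_unique) (simp_all add: cs)
  have p_rest: "p a = 0" if "const_seq a \<in> rest W" for a
    using that P.subspace_0[OF sub[OF W]] by (intro p_unique) (simp_all add: cs)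
  have coaction_W': "const_coaction w \<in> tensor_space pw sc W' UNIV" if "W' \<in> F" "w \<in> W'" for W' w
    using simple[OF that(1)] that(2) unfolding simple_comodule_def comodule_def by blast
  \<comment> \<open>the complement of \<open>W\<close> is a subcomodule, as a sum of subcomodules\<close>
  have coaction_rest: "const_coaction r \<in> tensor_space pw sc (rest W) UNIV" if "r \<in> rest W" for r
    using that unfolding rest_def
  proof (induction rule: P.span_induct_alt)
    case base
    have "const_coaction 0 = 0" using const_coaction_linear(1)[of 0 0] by (simp only: add_0_left add_cancel_right_right)
    then have "const_coaction 0 \<in> tensor_space pw sc (P.span (\<Union>(F - {W}))) UNIV"
      unfolding tensor_space_def using T.span_zero by (simp only:)
    then show ?case .
  next
    case (step c x y)
    then obtain W' where W': "W' \<in> F" "W' \<noteq> W" "x \<in> W'" by blast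
    have "tensor_space pw sc W' UNIV \<subseteq> tensor_space pw sc (P.span (\<Union>(F - {W}))) UNIV"
    proof -
      have "W' \<subseteq> P.span (\<Union>(F - {W}))"
        by (rule order_trans[OF _ P.span_superset]) (use W' in blast)
      then show ?thesis unfolding tensor_space_def by (intro T.span_mono) auto
    qed
    then have "const_coaction x \<in> tensor_space pw sc (P.span (\<Union>(F - {W}))) UNIV"
      using coaction_W'[OF W'(1,3)] by blast
    then show ?case using step
      unfolding const_coaction_linear tensor_space_def by (intro T.span_add T.span_scale)
  qed
  \<comment> \<open>The coaction on a subcomodule \<open>X\<close> only involves legs in \<open>X\<close>, so linear maps that agree on \<open>X\<close> cannot be told apart there.\<close>
  have coaction_eq: "sw (\<lambda>u w. \<beta> (f u) w) a = sw (\<lambda>u w. \<beta> (g u) w) a"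
    if X: "P.subspace X" "const_coaction (const_seq a) \<in> tensor_space pw sc X UNIV"
      and \<beta>: "bilinear_form sc sc \<beta>" and fg: "\<And>u. const_seq u \<in> X \<Longrightarrow> f u = g u" and "X \<subseteq> range const_seq"
      and f: "\<And>u v. f (u + v) = f u + f v" "\<And>c u. f (sc c u) = sc c (f u)"
      and g: "\<And>u v. g (u + v) = g u + g v" "\<And>c u. g (sc c u) = sc c (g u)"
    for X \<beta> f g a
  proof -
    obtain qs where qs: "set qs \<subseteq> X \<times> UNIV" "const_coaction (const_seq a) = tensor_sum pw sc qs"
      using tensor_space_imp_list[OF vs_pw vs X] by metis
    have eval: "sw (\<lambda>u w. \<beta> (f u) w) a = (\<Sum>(v, w)\<leftarrow>qs. \<beta> (f (v 0)) w)"
      if "\<And>u v. f (u + v) = f u + f v" "\<And>c u. f (sc c u) = sc c (f u)" for f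
    proof -
      have "bilinear_form pw sc (\<lambda>v w. \<beta> (f (v 0)) w)"
        using \<beta> that by (simp add: form_iff bilinear_form_iff[OF vs_pw vs] pointwise_apply)
      with fun_cong[OF qs(2), of "\<lambda>v w. \<beta> (f (v 0)) w"] show ?thesis
        by (simp add: const_coaction_eval tensor_sum_apply cs)
    qed
    have "f (v 0) = g (v 0)" if "(v, w) \<in> set qs" for v w
    proof -
      have "v \<in> X" using that qs(1) by blast
      moreover then have "const_seq (v 0) = v" using \<open>X \<subseteq> range const_seq\<close> by (auto simp: const_seq_def)
      ultimately show ?thesis using fg by simp
    qed
    then have "(\<Sum>(v, w)\<leftarrow>qs. \<beta> (f (v 0)) w) = (\<Sum>(v, w)\<leftarrow>qs. \<beta> (g (v 0)) w)"
      by (auto intro!: arg_cong[where f = sum_list])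
    then show ?thesis by (simp add: eval f g)
  qed
  have W_range: "W \<subseteq> range const_seq" using W P.span_base span by blast
  have rest_range: "rest W \<subseteq> range const_seq"
    unfolding rest_def span[symmetric] by (rule P.span_mono) auto
  have colinear: "sw (\<lambda>u v. \<beta> (p u) v) a = sw \<beta> (p a)" if \<beta>: "bilinear_form sc sc \<beta>" for \<beta> a
  proof -
    have bil: "bilinear_form sc sc (\<lambda>u v. \<beta> (p u) v)"
      using \<beta> by (simp add: form_iff p_add p_scale)
    have zero: "\<beta> 0 v = 0" for v
      using \<beta> form_iff(2)[of \<beta>] by (metis scale_zero_left mult_zero_left)
    have "sw (\<lambda>u v. \<beta> (p u) v) (p a) = sw (\<lambda>u v. \<beta> u v) (p a)"
      by (rule coaction_eq[OF sub[OF W] coaction_W'[OF W p(1)] \<beta>]) (simp_all add: p_W W_range p_add p_scale)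
    moreover have "sw (\<lambda>u v. \<beta> (p u) v) (a - p a) = sw (\<lambda>u v. \<beta> 0 v) (a - p a)"
      by (rule coaction_eq[OF rest_sub coaction_rest[OF p(2)] \<beta>]) (simp_all add: p_rest rest_range p_add p_scale)
    moreover have "sw (\<lambda>u v. \<beta> (p u) v) (p a + (a - p a)) = sw (\<lambda>u v. \<beta> (p u) v) (p a) + sw (\<lambda>u v. \<beta> (p u) v) (a - p a)"
      by (rule sweedler_linear(1)[OF bil])
    ultimately show ?thesis by (simp add: zero)
  qed
  have form: "sw (\<lambda>u v. \<epsilon> (p u) * \<phi> v) a = \<phi> (p a)" if \<phi>: "Vector_Spaces.linear sc (*) \<phi>" for \<phi> a
  proof -
    have "bilinear_form sc sc (\<lambda>u v. \<epsilon> u * \<phi> v)"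
      using \<phi> by (simp add: form_iff multilinear algebra_simps)
    from colinear[OF this, of a] show ?thesis by (simp add: form_counit_left[OF \<phi>])
  qed
  have p_one: "p 1 = sc (\<epsilon> (p 1)) 1"
  proof (rule form_eqI)
    fix \<phi> assume \<phi>: "Vector_Spaces.linear sc (*) \<phi>"
    have "bilinear_form sc sc (\<lambda>u v. \<epsilon> (p u) * \<phi> v)"
      using \<phi> by (simp add: form_iff multilinear p_add p_scale algebra_simps)
    from sweedler_one[OF this] form[OF \<phi>, of 1] show "\<phi> (p 1) = \<phi> (sc (\<epsilon> (p 1)) 1)"
      using \<phi> by (simp add: form_iff)
  qed
  have "p 1 \<noteq> 0" using p(2)[of 1] one by auto
  then have c: "\<epsilon> (p 1) \<noteq> 0" using p_one by (metis scale_zero_left)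
  let ?U = "range (\<lambda>c. sc c 1)"
  \<comment> \<open>rescale \<open>p 1\<close>, a nonzero multiple of the unit that lies in \<open>W\<close>\<close>
  have "const_seq 1 = pw (inverse (\<epsilon> (p 1))) (const_seq (p 1))"
    using c by (subst p_one) (simp flip: const_seq_scale')
  then have one_W: "const_seq 1 \<in> W" using P.subspace_scale[OF sub[OF W] p(1)] by simp
  have U: "subspace ?U"
    unfolding subspace_def
    by (auto simp flip: scale_left_distrib intro: range_eqI[of 0 _ 0])
  have "comodule pw H (const_seq ` ?U) const_coaction"
  proof (rule const_comodule[OF U])
    fix a assume "a \<in> ?U"
    then obtain d where a: "a = sc d 1" by blast
    have "comult H a = tensor_sum sc sc [(a, 1)]"
      using linear_comult unfolding a
      by (simp add: Vector_Spaces.linear_iff bialgebra_laws tensor_scale_left vs)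
    then show "comult H a \<in> tensor_space sc sc ?U UNIV"
      using tensor_sum_in_tensor_space[of "[(a, 1)]" ?U UNIV sc sc] a by auto
  qed
  moreover have "const_seq ` ?U \<subseteq> W"
    using P.subspace_scale[OF sub[OF W] one_W] by (auto simp: cs)
  moreover have "const_seq ` ?U \<noteq> {0}"
  proof -
    have "const_seq (sc 1 1) \<in> const_seq ` ?U" by blast
    moreover have "const_seq (sc 1 1) \<noteq> 0" by (simp add: const_seq_def fun_eq_iff)
    ultimately show ?thesis by blast
  qed
  ultimately have W_eq: "W = const_seq ` ?U"
    using simple[OF W] unfolding simple_comodule_def by blast
  have p_scalar: "p a = sc (\<epsilon> (p a)) 1" for a
  proof -
    have "const_seq (p a) \<in> const_seq ` ?U" using p(1) W_eq by blast
    then obtain d where "p a = sc d 1" by (auto simp: const_seq_simps)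
    then show ?thesis by (simp add: counit_linear bialgebra_laws)
  qed
  have "haar (\<lambda>a. \<epsilon> (p a))"
    unfolding haar_def
  proof (intro conjI allI)
    show "Vector_Spaces.linear sc (*) (\<lambda>a. \<epsilon> (p a))" by (simp add: form_iff p_add p_scale counit_linear)
    show "\<epsilon> (p 1) = 1" by (simp add: p_W one_W bialgebra_laws)
    fix a
    show "sw (\<lambda>u v. sc (\<epsilon> (p u)) v) a = sc (\<epsilon> (p a)) 1"
    proof (rule form_eqI)
      fix \<phi> assume \<phi>: "Vector_Spaces.linear sc (*) \<phi>"
      have "\<phi> (sw (\<lambda>u v. sc (\<epsilon> (p u)) v) a) = sw (\<lambda>u v. \<epsilon> (p u) * \<phi> v) a"
        using linear_sweedler[OF \<phi>, of H "\<lambda>u v. sc (\<epsilon> (p u)) v" a] \<phi> by (simp add: form_iff)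
      then show "\<phi> (sw (\<lambda>u v. sc (\<epsilon> (p u)) v) a) = \<phi> (sc (\<epsilon> (p a)) 1)"
        using form[OF \<phi>] p_scalar by metis
    qed
  qed
  then show ?thesis by blast
qed

end

section \<open>Hopf algebra maps with trivial coinvariants\<close>

lemma (in hopf) coinvariants_iff:
  assumes "hopf_algebra K" "Vector_Spaces.linear sc (scale K) p"
  shows "a \<in> coinvariants H K p \<longleftrightarrow>
    (\<forall>\<beta>. bilinear_form sc (scale K) \<beta> \<longrightarrow> sw (\<lambda>u v. \<beta> u (p v)) a = \<beta> a 1)"
proof -
  interpret K: hopf K by standard (rule assms)
  have "tensor_map sc sc sc (scale K) id p (comult H a) = sw (\<lambda>u v. tensor sc (scale K) u (p v)) a"
    unfolding tensor_map_def
    using assms(2)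
    by (subst tensor_lift_comult[OF vector_space_tensor])
      (simp_all add: tensor_add_left tensor_add_right tensor_scale_left tensor_scale_right vs K.vs Vector_Spaces.linear_iff)
  then have "tensor_map sc sc sc (scale K) id p (comult H a) \<beta> =
      (if bilinear_form sc (scale K) \<beta> then sw (\<lambda>u v. \<beta> u (p v)) a else 0)" for \<beta>
    by (simp add: sweedler_apply tensor_def)
  then show ?thesis
    by (auto simp: coinvariants_def fun_eq_iff tensor_def)
qed

lemma sweedler_hopf_map:
  assumes "hopf_algebra G" "hopf_algebra H" and f: "hopf_map G H f"
    and \<beta>: "bilinear_form (scale H) (scale H) \<beta>"
  shows "sweedler H \<beta> (f x) = sweedler G (\<lambda>u v. \<beta> (f u) (f v)) x"
proof -
  interpret G: hopf G by standard (rule assms)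
  interpret H: hopf H by standard (rule assms)
  have "comult H (f x) = tensor_map (scale G) (scale G) (scale H) (scale H) f f (comult G x)"
    using f unfolding hopf_map_def by blast
  also have "\<dots> = sweedler G (\<lambda>u v. tensor (scale H) (scale H) (f u) (f v)) x"
    unfolding tensor_map_def
    using f
    by (subst G.tensor_lift_comult[OF vector_space_tensor])
      (simp_all add: tensor_add_left tensor_add_right tensor_scale_left tensor_scale_right H.vs Vector_Spaces.linear_iff hopf_map_def)
  finally show ?thesis
    using \<beta> by (simp add: H.sweedler_eval G.sweedler_apply) (simp add: tensor_def)
qed

text \<open>
  Put \<open>x = h(f a\<^sub>1) a\<^sub>2\<close>. Invariance of \<open>h\<close> gives \<open>f x\<^sub>1 \<otimes> x\<^sub>2 = 1 \<otimes> x\<close>, and the antipode turns this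
  left-handed coinvariance into the right-handed one, \<open>(S x)\<^sub>1 \<otimes> f (S x)\<^sub>2 = S x \<otimes> 1\<close>. So \<open>S x\<close> is a
  scalar, and so is \<open>x\<close>; the counit identifies it as \<open>h(f a) 1\<close>.
\<close>

lemma haar_pullback:
  assumes "hopf_algebra G" "hopf_algebra H" and f: "hopf_map G H f"
    and inj: "inj (antipode G)" and h: "hopf.haar H h"
    and coinv: "coinvariants G H f \<subseteq> range (\<lambda>c. scale G c 1)"
  shows "hopf.haar G (h \<circ> f)"
proof -
  interpret G: hopf G by standard (rule assms)
  interpret H: hopf H by standard (rule assms)
  have f_lin: "f (x + y) = f x + f y" "f (scale G c x) = scale H c (f x)" "f (antipode G x) = antipode H (f x)"
    "f 1 = 1" and linf: "Vector_Spaces.linear (scale G) (scale H) f" for x y c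
    using f by (auto simp: hopf_map_def Vector_Spaces.linear_iff)
  have h_lin: "h (u + v) = h u + h v" "h (scale H c u) = c * h u" "h 1 = 1" for u v c
    using h by (simp_all add: H.haar_def H.form_iff)
  have "G.sw (\<lambda>u v. scale G (h (f u)) v) a = scale G (h (f a)) 1" for a
  proof -
    define x where "x = G.sw (\<lambda>u v. scale G (h (f u)) v) a"
    have x_form: "\<phi> x = G.sw (\<lambda>u v. h (f u) * \<phi> v) a" if "Vector_Spaces.linear (scale G) (*) \<phi>" for \<phi>
      unfolding x_def using linear_sweedler[OF that, of G "\<lambda>u v. scale G (h (f u)) v" a] that
      by (simp add: G.form_iff)
    have "G.S x \<in> coinvariants G H f"
      unfolding G.coinvariants_iff[OF assms(2) linf]
    proof (intro allI impI)
      fix \<beta> assume \<beta>: "bilinear_form (scale G) (scale H) \<beta>"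
      have lin: "\<beta> (u + v) w = \<beta> u w + \<beta> v w" "\<beta> u (w + z) = \<beta> u w + \<beta> u z"
        "\<beta> (scale G c u) w = c * \<beta> u w" "\<beta> u (scale H c w) = c * \<beta> u w" for u v w z c
        using \<beta> by (simp_all add: bilinear_form_iff[OF G.vs H.vs])
      have bil: "bilinear_form (scale G) (scale G) (\<lambda>u v. \<beta> u (f v))"
        and bilS: "bilinear_form (scale G) (scale G) (\<lambda>u v. \<beta> (G.S v) (H.S (f u)))"
        by (simp_all add: G.form_iff lin f_lin G.multilinear H.multilinear)
      have "G.sw (\<lambda>u v. \<beta> u (f v)) (G.S x) = G.sw (\<lambda>u v. \<beta> (G.S v) (H.S (f u))) x"
        by (simp add: G.sweedler_antipode[OF bil] f_lin)
      also have "\<dots> = G.sw (\<lambda>u v. h (f u) * G.sw (\<lambda>p q. \<beta> (G.S q) (H.S (f p))) v) a"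
        by (rule x_form) (simp add: G.form_iff G.sweedler_linear[OF bilS])
      also have "\<dots> = G.sw (\<lambda>u v. G.sw (\<lambda>p q. h (f u) * \<beta> (G.S q) (H.S (f p))) v) a"
        by (simp add: sweedler_mult_left)
      \<comment> \<open>regroup so that \<open>h\<close> meets both legs of \<open>f\<close> applied to one element, where its invariance applies\<close>
      also have "\<dots> = G.sw (\<lambda>w q. G.sw (\<lambda>u p. h (f u) * \<beta> (G.S q) (H.S (f p))) w) a"
        by (rule G.coassoc[symmetric])
          (simp add: G.trilinear_def lin f_lin h_lin G.multilinear H.multilinear algebra_simps)
      also have "\<dots> = G.sw (\<lambda>w q. h (f w) * \<beta> (G.S q) 1) a"
      proof -
        have "G.sw (\<lambda>u p. h (f u) * \<beta> (G.S q) (H.S (f p))) w = h (f w) * \<beta> (G.S q) 1" for w q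
        proof -
          have "bilinear_form (scale H) (scale H) (\<lambda>u p. h u * \<beta> (G.S q) (H.S p))"
            by (simp add: H.form_iff lin h_lin H.multilinear algebra_simps)
          from sweedler_hopf_map[OF assms(1,2) f this, of w]
          have "G.sw (\<lambda>u p. h (f u) * \<beta> (G.S q) (H.S (f p))) w = H.sw (\<lambda>u p. h u * \<beta> (G.S q) (H.S p)) (f w)" ..
          also have "\<dots> = h (f w) * \<beta> (G.S q) (H.S 1)"
            by (rule H.haar_form[OF h]) (simp add: H.form_iff lin H.multilinear)
          finally show ?thesis by (simp add: H.antipode_one)
        qed
        then show ?thesis by simp
      qed
      also have "\<dots> = \<beta> (G.S x) 1"
        by (rule x_form[symmetric]) (simp add: G.form_iff lin G.multilinear)
      finally show "G.sw (\<lambda>u v. \<beta> u (f v)) (G.S x) = \<beta> (G.S x) 1" .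
    qed
    then obtain c where "G.S x = scale G c 1" using coinv by blast
    also have "\<dots> = G.S (scale G c 1)" by (simp add: G.multilinear G.antipode_one)
    finally have x: "x = scale G c 1" using inj by (simp add: inj_eq)
    have "c = G.\<epsilon> x" by (simp add: x G.counit_linear G.bialgebra_laws)
    also have "\<dots> = G.sw (\<lambda>u v. h (f u) * G.\<epsilon> v) a" by (rule x_form[OF G.linear_counit])
    also have "\<dots> = h (f a)" by (rule G.form_counit_right) (simp add: G.form_iff f_lin h_lin)
    finally show ?thesis using x by (simp add: x_def)
  qed
  then show ?thesis by (simp add: G.haar_def G.form_iff f_lin h_lin)
qed

theorem inj_if_trivial_coinvariants:
  assumes "hopf_algebra G" "cosemisimple G" "hopf_algebra H" "cosemisimple H" and f: "hopf_map G H f"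
    and coinv: "coinvariants G H f \<subseteq> range (\<lambda>c. scale G c 1)"
  shows "inj f"
proof -
  interpret G: hopf G by standard (rule assms)
  interpret H: hopf H by standard (rule assms)
  obtain g where g: "G.haar g" using G.cosemisimple_haar assms(2) by blast
  obtain h where h: "H.haar h" using H.cosemisimple_haar assms(4) by blast
  have pull: "G.haar (h \<circ> f)"
    by (rule haar_pullback[OF assms(1,3) f G.inj_antipode[OF g] h coinv])
  have zero: "x = 0" if "f x = 0" for x
  proof (rule G.haar_faithful[OF pull])
    fix y
    have "f (G.S x * y) = H.S 0 * f y" using f that by (simp add: hopf_map_def)
    also have "H.S 0 = 0" using H.antipode_linear(2)[of 0 0] by simp
    finally have "f (G.S x * y) = 0" by simp
    moreover have "h 0 = 0" using h H.form_iff(1)[of h] unfolding H.haar_def by (metis H.scale_zero_left mult_zero_left)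
    ultimately show "(h \<circ> f) (G.S x * y) = 0" by simp
  qed
  interpret lf: Vector_Spaces.linear "scale G" "scale H" f using f by (simp add: hopf_map_def)
  show ?thesis using zero by (subst lf.inj_iff_eq_0) simp
qed

theorem theorem3p4:
  fixes B :: "('k::field, 'b::ring_1) hopf_data"
    and A :: "('k, 'a::ring_1) hopf_data"
    and A' :: "('k, 'c::ring_1) hopf_data"
    and L :: "('k, 'l::ring_1) hopf_data"
    and i :: "'b \<Rightarrow> 'a" and \<pi> :: "'a \<Rightarrow> 'l"
    and i' :: "'b \<Rightarrow> 'c" and \<pi>' :: "'c \<Rightarrow> 'l"
    and \<theta> :: "'a \<Rightarrow> 'c"
  assumes "hopf_algebra B" and "cosemisimple B"
    and "hopf_algebra A" and "cosemisimple A"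
    and "hopf_algebra A'" and "cosemisimple A'"
    and "hopf_algebra L" and "cosemisimple L"
    and "pre_exact B A L i \<pi>"
    and "pre_exact B A' L i' \<pi>'"
    and "hopf_map A A' \<theta>"
    and "\<theta> \<circ> i = i'"
    and "\<pi>' \<circ> \<theta> = \<pi>"
  shows "inj \<theta>"
proof (rule inj_if_trivial_coinvariants)
  interpret A: hopf A by standard (rule assms)
  interpret A': hopf A' by standard (rule assms)
  interpret L: hopf L by standard (rule assms)
  have i: "Vector_Spaces.linear (scale B) (scale A) i" "i 1 = 1" "range i = coinvariants A L \<pi>"
    and \<pi>: "Vector_Spaces.linear (scale A) (scale L) \<pi>"
    using assms(9) by (auto simp: pre_exact_def hopf_map_def)
  have i': "Vector_Spaces.linear (scale B) (scale A') i'" "i' 1 = 1" "inj i'"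
    and \<pi>': "Vector_Spaces.linear (scale A') (scale L) \<pi>'" "\<pi>' 1 = 1"
    using assms(10) by (auto simp: pre_exact_def hopf_map_def)
  have \<theta>: "Vector_Spaces.linear (scale A) (scale A') \<theta>"
    using assms(11) by (auto simp: hopf_map_def)
  show "coinvariants A A' \<theta> \<subseteq> range (\<lambda>c. scale A c 1)"
  proof
    fix a assume "a \<in> coinvariants A A' \<theta>"
    then have a: "A.sw (\<lambda>u v. \<beta> u (\<theta> v)) a = \<beta> a 1" if "bilinear_form (scale A) (scale A') \<beta>" for \<beta>
      using that by (simp add: A.coinvariants_iff[OF assms(5) \<theta>])
    have "a \<in> coinvariants A L \<pi>"
      unfolding A.coinvariants_iff[OF assms(7) \<pi>]
    proof (intro allI impI)
      fix \<beta> assume "bilinear_form (scale A) (scale L) \<beta>"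
      then have "bilinear_form (scale A) (scale A') (\<lambda>u v. \<beta> u (\<pi>' v))"
        using \<pi>'(1) by (simp add: bilinear_form_iff[OF A.vs L.vs] bilinear_form_iff[OF A.vs A'.vs] Vector_Spaces.linear_iff)
      from a[OF this] show "A.sw (\<lambda>u v. \<beta> u (\<pi> v)) a = \<beta> a 1"
        using assms(13) \<pi>'(2) by auto
    qed
    then obtain b where b: "a = i b" using i(3) by blast
    \<comment> \<open>counit on the first leg of \<open>a\<^sub>1 \<otimes> \<theta> a\<^sub>2 = a \<otimes> 1\<close>\<close>
    have "\<theta> a = scale A' (A.\<epsilon> a) 1"
    proof (rule A'.form_eqI)
      fix \<phi> assume \<phi>: "Vector_Spaces.linear (scale A') (*) \<phi>"
      have "bilinear_form (scale A) (scale A') (\<lambda>u v. A.\<epsilon> u * \<phi> v)"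
        using \<phi> by (simp add: bilinear_form_iff[OF A.vs A'.vs] A'.form_iff A.counit_linear algebra_simps)
      from a[OF this] have "A.sw (\<lambda>u v. A.\<epsilon> u * \<phi> (\<theta> v)) a = A.\<epsilon> a * \<phi> 1" .
      moreover have "Vector_Spaces.linear (scale A) (*) (\<lambda>v. \<phi> (\<theta> v))"
        using \<phi> \<theta> by (simp add: A.form_iff A'.form_iff Vector_Spaces.linear_iff)
      ultimately show "\<phi> (\<theta> a) = \<phi> (scale A' (A.\<epsilon> a) 1)"
        using \<phi> by (simp add: A.form_counit_left A'.form_iff)
    qed
    then have "i' b = i' (scale B (A.\<epsilon> a) 1)"
      using i' assms(12) b by (auto simp: Vector_Spaces.linear_iff)
    then have "b = scale B (A.\<epsilon> a) 1" using i'(3) by (simp add: inj_eq)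
    then have "a = scale A (A.\<epsilon> a) 1" using i b by (metis Vector_Spaces.linear_iff)
    then show "a \<in> range (\<lambda>c. scale A c 1)" by blast
  qed
qed (use assms in blast)+

end
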